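(* Let $W$ be the $2|1$-dimensional complex $\mathbb Z_2$-graded vector space with basis $w_1$ (odd), $w_2,w_3$ (even). Every nonzero codifferential of degree $2$ of the second kind on $W$, i.e. every nonzero $$d=\psi^{0,2,0}_1a+\psi^{0,1,1}_1b+\psi^{0,0,2}_1c,\qquad a,b,c\in\mathbb C,$$ is equivalent to exactly one of the two codifferentials $\psi^{0,2,0}_1$ and $\psi^{0,1,1}_1$.
   Context: All spaces are $\mathbb Z_2$-graded over $\mathbb C$. $S(W)=\bigoplus_{n\ge1}S^n(W)$ is the symmetric coalgebra of $W$ (so $w_1^2=0$). $L_n=\mathrm{Hom}(S^n(W),W)$, and $L=\prod_{n\ge1}L_n$ is identified with the coderivations of $S(W)$; it is a $\mathbb Z_2$-graded Lie algebra under the graded commutator. A codifferential is an odd $d\in L$ with $[d,d]=0$; it has degree $n$ if $d\in L_n$. For a multi-index $I=(i_1,i_2,i_3)$ with $i_1\in\{0,1\}$, $i_2,i_3\ge0$, put $w_I=w_1^{i_1}w_2^{i_2}w_3^{i_3}$, $I!=i_1!i_2!i_3!$, and let $\varphi^I_j\in\mathrm{Hom}(S^{|I|}(W),W)$ be given by $\varphi^I_j(w_J)=I!\,\delta^I_J\,w_j$; when this element is odd it is written $\psi^I_j$. Every combination of the $\psi^{0,p,2-p}_1$ ($p=0,1,2$) is a codifferential. Two codifferentials $d,d'$ are equivalent if $d'=g^{-1}dg$ for some (even) coalgebra automorphism $g$ of $S(W)$, i.e. one determined by an even $g=g_1+g_2+\cdots\in\mathrm{Hom}(S(W),W)$ with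 $g_1:W\to W$ invertible. *)

theory Defs
  imports Complex_Main "HOL-Library.Poly_Mapping" "HOL-Library.Product_Plus"
begin

text \<open>Throughout, \<open>W\<close> is the $2|1$-dimensional space with odd basis vector $w_1$ and even
  basis vectors $w_2, w_3$, and \<open>S(W)\<close> is the symmetric coalgebra without the degree-zero part.\<close>

subsection \<open>Free complex vector spaces\<close>

definition scale :: "complex \<Rightarrow> ('k \<Rightarrow>\<^sub>0 complex) \<Rightarrow> ('k \<Rightarrow>\<^sub>0 complex)" where
  "scale c x = Poly_Mapping.map ((*) c) x"

lemma lookup_scale [simp]: "Poly_Mapping.lookup (scale c x) k = c * Poly_Mapping.lookup x k"
  by (simp add: scale_def Poly_Mapping.map.rep_eq when_def)

lemma vector_space_scale: "vector_space (scale :: complex \<Rightarrow> ('k \<Rightarrow>\<^sub>0 complex) \<Rightarrow> _)"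
  by unfold_locales (rule poly_mapping_eqI; simp add: lookup_add algebra_simps)+

abbreviation complex_linear :: "(('k \<Rightarrow>\<^sub>0 complex) \<Rightarrow> ('l \<Rightarrow>\<^sub>0 complex)) \<Rightarrow> bool" where
  "complex_linear \<equiv> Vector_Spaces.linear scale scale"

definition lin_ext :: "('k \<Rightarrow> ('l \<Rightarrow>\<^sub>0 complex)) \<Rightarrow> ('k \<Rightarrow>\<^sub>0 complex) \<Rightarrow> ('l \<Rightarrow>\<^sub>0 complex)" where
  "lin_ext F x = (\<Sum>k\<in>Poly_Mapping.keys x. scale (Poly_Mapping.lookup x k) (F k))"

subsection \<open>The space \<open>S(W)\<close>\<close>

typedef multi_index = 
  "{I :: nat \<times> nat \<times> nat. case I of (i1, i2, i3) \<Rightarrow> i1 \<le> 1 \<and> i1 + i2 + i3 \<ge> 1}"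
  morphisms exps Abs_multi_index
  by (rule exI[of _ "(1, 0, 0)"]) simp

abbreviation mi :: "nat \<Rightarrow> nat \<Rightarrow> nat \<Rightarrow> multi_index" where
  "mi i1 i2 i3 \<equiv> Abs_multi_index (i1, i2, i3)"

type_synonym SW = "multi_index \<Rightarrow>\<^sub>0 complex"

type_synonym SW2 = "(multi_index \<times> multi_index) \<Rightarrow>\<^sub>0 complex"

definition mon :: "multi_index \<Rightarrow> SW" where
  "mon I = Poly_Mapping.single I 1"

definition total_degree :: "multi_index \<Rightarrow> nat" where
  "total_degree I = (case exps I of (i1, i2, i3) \<Rightarrow> i1 + i2 + i3)"

text \<open>Only $w_1$ is odd, so the parity of $w_I$ is $i_1 \in \{0,1\}$.\<close>

definition parity :: "multi_index \<Rightarrow> nat" where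
  "parity I = (case exps I of (i1, i2, i3) \<Rightarrow> i1)"

definition multi_fact :: "multi_index \<Rightarrow> nat" where
  "multi_fact I = (case exps I of (i1, i2, i3) \<Rightarrow> fact i1 * fact i2 * fact i3)"

definition multi_choose :: "multi_index \<Rightarrow> multi_index \<Rightarrow> nat" where
  "multi_choose I J = (case exps I of (i1, i2, i3) \<Rightarrow> case exps J of (j1, j2, j3) \<Rightarrow>
     (i1 choose j1) * (i2 choose j2) * (i3 choose j3))"

text \<open>\<open>W\<close> is identified with $S^1(W)$; \<open>gen j\<close> is the multi-index of $w_j$.\<close>

datatype basis_index = B1 | B2 | B3

fun gen :: "basis_index \<Rightarrow> multi_index" where
  "gen B1 = mi 1 0 0"
| "gen B2 = mi 0 1 0"
| "gen B3 = mi 0 0 1"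

definition W :: "SW set" where
  "W = {x. \<forall>I\<in>Poly_Mapping.keys x. total_degree I = 1}"

definition proj_W :: "SW \<Rightarrow> SW" where
  "proj_W = lin_ext (\<lambda>I. if total_degree I = 1 then mon I else 0)"

definition map_parity :: "nat \<Rightarrow> (SW \<Rightarrow> SW) \<Rightarrow> bool" where
  "map_parity p f \<longleftrightarrow>
     (\<forall>I. \<forall>J\<in>Poly_Mapping.keys (f (mon I)). even (parity I + parity J + p))"

subsection \<open>The coalgebra structure\<close>

definition splits :: "multi_index \<Rightarrow> (multi_index \<times> multi_index) set" where
  "splits I = {(J, K). exps J + exps K = exps I}"

lemma finite_splits: "finite (splits I)"
proof -
  obtain a b c where I: "exps I = (a, b, c)" by (cases "exps I") auto
  let ?B = "{..a} \<times> {..b} \<times> {..c}"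
  have "map_prod exps exps ` splits I \<subseteq> ?B \<times> ?B"
  proof
    fix z assume "z \<in> map_prod exps exps ` splits I"
    then obtain J K where z: "z = (exps J, exps K)" and JK: "exps J + exps K = (a, b, c)"
      by (auto simp: splits_def I)
    show "z \<in> ?B \<times> ?B"
      using JK by (cases "exps J"; cases "exps K") (auto simp: z)
  qed
  then have "finite (map_prod exps exps ` splits I)"
    by (rule finite_subset) simp
  moreover have "inj_on (map_prod exps exps) (splits I)"
    by (auto simp: inj_on_def exps_inject)
  ultimately show ?thesis by (rule finite_imageD)
qed

text \<open>The unshuffle coproduct $w_I \mapsto \sum_{J+K=I;\ J,K\neq 0} \binom{I}{J}\, w_J\otimes w_K$.
  Unshuffling $w_I$ never interchanges two odd factors, because $w_1$ is the only odd generator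
  and occurs at most once; hence there is no Koszul sign.\<close>

definition coproduct :: "SW \<Rightarrow> SW2" where
  "coproduct = lin_ext (\<lambda>I. \<Sum>(J, K)\<in>splits I.
     Poly_Mapping.single (J, K) (of_nat (multi_choose I J)))"

definition tensor :: "SW \<Rightarrow> SW \<Rightarrow> SW2" where
  "tensor x y = (\<Sum>J\<in>Poly_Mapping.keys x. \<Sum>K\<in>Poly_Mapping.keys y.
     Poly_Mapping.single (J, K) (Poly_Mapping.lookup x J * Poly_Mapping.lookup y K))"

text \<open>\<open>tensor_map f q g\<close> is $f \otimes g$ for \<open>g\<close> of parity \<open>q\<close>, with the Koszul sign
  $(f\otimes g)(x\otimes y) = (-1)^{|g||x|} f(x)\otimes g(y)$.\<close>

definition tensor_map :: "(SW \<Rightarrow> SW) \<Rightarrow> nat \<Rightarrow> (SW \<Rightarrow> SW) \<Rightarrow> SW2 \<Rightarrow> SW2" where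
  "tensor_map f q g = lin_ext (\<lambda>(J, K).
     scale ((-1) ^ (q * parity J)) (tensor (f (mon J)) (g (mon K))))"

definition coderivation :: "nat \<Rightarrow> (SW \<Rightarrow> SW) \<Rightarrow> bool" where
  "coderivation p D \<longleftrightarrow> complex_linear D \<and> map_parity p D \<and>
     (\<forall>x. coproduct (D x) =
        tensor_map D 0 id (coproduct x) + tensor_map id p D (coproduct x))"

definition coalgebra_automorphism :: "(SW \<Rightarrow> SW) \<Rightarrow> bool" where
  "coalgebra_automorphism g \<longleftrightarrow> complex_linear g \<and> map_parity 0 g \<and> bij g \<and>
     (\<forall>x. coproduct (g x) = tensor_map g 0 g (coproduct x))"

subsection \<open>Cochains and codifferentials\<close>

text \<open>Since $S(W)$ is a direct sum, $\prod_{n\ge1} \mathrm{Hom}(S^n(W),W)$ is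
  $\mathrm{Hom}(S(W),W)$; this is its part of parity \<open>p\<close>.\<close>

definition cochain :: "nat \<Rightarrow> (SW \<Rightarrow> SW) \<Rightarrow> bool" where
  "cochain p d \<longleftrightarrow> complex_linear d \<and> map_parity p d \<and> range d \<subseteq> W"

text \<open>The identification of cochains with coderivations: since $S(W)$ is cofree, each cochain is
  the corestriction to \<open>W\<close> of exactly one coderivation.\<close>

definition coder :: "nat \<Rightarrow> (SW \<Rightarrow> SW) \<Rightarrow> (SW \<Rightarrow> SW)" where
  "coder p d = (THE D. coderivation p D \<and> proj_W \<circ> D = d)"

definition graded_commutator ::
    "nat \<Rightarrow> nat \<Rightarrow> (SW \<Rightarrow> SW) \<Rightarrow> (SW \<Rightarrow> SW) \<Rightarrow> (SW \<Rightarrow> SW)" where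
  "graded_commutator p q D E = (\<lambda>x. D (E x) - scale ((-1) ^ (p * q)) (E (D x)))"

definition codifferential :: "(SW \<Rightarrow> SW) \<Rightarrow> bool" where
  "codifferential d \<longleftrightarrow> cochain 1 d \<and> graded_commutator 1 1 (coder 1 d) (coder 1 d) = (\<lambda>x. 0)"

definition codiff_equivalent :: "(SW \<Rightarrow> SW) \<Rightarrow> (SW \<Rightarrow> SW) \<Rightarrow> bool" where
  "codiff_equivalent d d' \<longleftrightarrow> codifferential d \<and> codifferential d' \<and>
     (\<exists>g. coalgebra_automorphism g \<and> coder 1 d' = inv g \<circ> coder 1 d \<circ> g)"

text \<open>$\varphi^I_j(w_J) = I!\,\delta^I_J\, w_j$, extended by zero to the other $S^n(W)$.\<close>

definition phi :: "multi_index \<Rightarrow> basis_index \<Rightarrow> SW \<Rightarrow> SW" where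
  "phi I j = lin_ext (\<lambda>J. if J = I then scale (of_nat (multi_fact I)) (mon (gen j)) else 0)"

definition second_kind :: "complex \<Rightarrow> complex \<Rightarrow> complex \<Rightarrow> SW \<Rightarrow> SW" where
  "second_kind a b c = (\<lambda>x. scale a (phi (mi 0 2 0) B1 x) + scale b (phi (mi 0 1 1) B1 x)
     + scale c (phi (mi 0 0 2) B1 x))"

end

theory Submission
  imports Defs "HOL-Computational_Algebra.Polynomial"
begin

text \<open>Since \<open>S(W)\<close> is cofree, coderivations and coalgebra morphisms are determined by their
  corestrictions to \<open>W\<close>; the codifferential attached to a quadratic form $ax^2+bxy+cy^2$ corresponds
  to the coderivation $w_1(a\partial_2^2+b\partial_2\partial_3+c\partial_3^2)$.  An automorphism
  maps $w_1$ to a multiple $\lambda w_1$ and acts linearly on $\langle w_2,w_3\rangle$, and comparing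
  values on quadratic monomials shows that equivalence substitutes this linear map into the form and
  rescales it by $\lambda$, so that vanishing of the discriminant is invariant.  Conversely every
  linear substitution extends to an automorphism, and a nonzero binary form over the complex numbers
  becomes $x^2$ or $xy$ according to its discriminant.\<close>

subsection \<open>Linear maps between free vector spaces\<close>

text \<open>Since \<open>coder\<close> is a definite description, it can be evaluated only by
  producing an explicit coderivation with the right corestriction; the differential operators are
  these witnesses, and cofreeness identifies them. Equivalence is used in the form d g = g d': both
  sides are coderivations along g, so this equation too can be tested after projection to
  \<open>W\<close>, without a formula for the inverse of g. An arbitrary automorphism has components
  g_2, g_3, ... besides its linear part g_1, but on a quadratic monomial they contribute at most an
  element of \<open>W\<close>, which d annihilates, while the quadratic component is given by g_1
  \<otimes> g_1. This is why a nonlinear change of coordinates yields nothing beyond linear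
  substitution and rescaling. For the normal forms, automorphisms fixing w_1 suffice, because over
  the complex numbers the remaining scalar can be absorbed into the substitution.\<close>

lemma scale_simps [simp]:
  "scale c 0 = 0" "scale 0 x = 0" "scale 1 x = x" "scale c (scale e x) = scale (c * e) x"
  by (rule poly_mapping_eqI, simp add: ac_simps)+

lemma scale_single [simp]: "scale c (Poly_Mapping.single k e) = Poly_Mapping.single k (c * e)"
  by (rule poly_mapping_eqI) (simp add: lookup_single when_def)

lemma scale_add: "scale c (x + y) = scale c x + scale c y"
  by (rule poly_mapping_eqI) (simp add: lookup_add algebra_simps)

lemma scale_add_left: "scale (c + e) x = scale c x + scale e x"
  by (rule poly_mapping_eqI) (simp add: lookup_add algebra_simps)

lemma scale_sum: "scale c (\<Sum>i\<in>A. f i) = (\<Sum>i\<in>A. scale c (f i))"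
  by (rule poly_mapping_eqI) (simp add: lookup_sum sum_distrib_left)

lemma complex_linearI:
  assumes "\<And>x y. f (x + y) = f x + f y" and "\<And>c x. f (scale c x) = scale c (f x)"
  shows "complex_linear f"
  unfolding Vector_Spaces.linear_def module_hom_def module_hom_axioms_def
  using assms by (auto simp: module_iff_vector_space vector_space_scale)

lemma complex_linear_add: "complex_linear f \<Longrightarrow> f (x + y) = f x + f y"
  and complex_linear_scale: "complex_linear f \<Longrightarrow> f (scale c x) = scale c (f x)"
  unfolding Vector_Spaces.linear_def module_hom_def module_hom_axioms_def by auto

lemma complex_linear_0: "complex_linear f \<Longrightarrow> f 0 = 0"
  using complex_linear_scale[of f 0 0] by simp

lemma complex_linear_sum: "complex_linear f \<Longrightarrow> f (\<Sum>i\<in>A. h i) = (\<Sum>i\<in>A. f (h i))"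
  by (induction A rule: infinite_finite_induct) (simp_all add: complex_linear_0 complex_linear_add)

lemma complex_linear_comp:
  "complex_linear f \<Longrightarrow> complex_linear h \<Longrightarrow> complex_linear (f \<circ> h)"
  by (rule complex_linearI) (simp_all add: complex_linear_add complex_linear_scale)

lemma complex_linear_id: "complex_linear id"
  by (rule complex_linearI) simp_all

lemma complex_linear_plus:
  "complex_linear f \<Longrightarrow> complex_linear h \<Longrightarrow> complex_linear (\<lambda>x. f x + h x)"
  by (rule complex_linearI) (simp_all add: complex_linear_add complex_linear_scale scale_add ac_simps)

lemma complex_linear_scale_fun:
  "complex_linear f \<Longrightarrow> complex_linear (\<lambda>x. scale c (f x))"
  by (rule complex_linearI) (simp_all add: complex_linear_add complex_linear_scale scale_add ac_simps)

text \<open>Coefficients may cancel in a sum, so linearity of \<open>lin_ext\<close> is checked over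
  a common finite set containing all keys involved.\<close>

lemma lin_ext_superset:
  assumes "finite S" and "Poly_Mapping.keys x \<subseteq> S"
  shows "lin_ext F x = (\<Sum>k\<in>S. scale (Poly_Mapping.lookup x k) (F k))"
  unfolding lin_ext_def using assms by (intro sum.mono_neutral_left) (auto simp: in_keys_iff)

lemma complex_linear_lin_ext: "complex_linear (lin_ext F)"
proof (rule complex_linearI)
  fix x y :: "'a \<Rightarrow>\<^sub>0 complex"
  let ?S = "Poly_Mapping.keys x \<union> Poly_Mapping.keys y"
  show "lin_ext F (x + y) = lin_ext F x + lin_ext F y"
    using Poly_Mapping.keys_add[of x y]
    by (simp add: lin_ext_superset[of ?S] lookup_add scale_add_left sum.distrib)
next
  fix c :: complex and x :: "'a \<Rightarrow>\<^sub>0 complex"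
  have "Poly_Mapping.keys (scale c x) \<subseteq> Poly_Mapping.keys x"
    by (auto simp: in_keys_iff)
  then show "lin_ext F (scale c x) = scale c (lin_ext F x)"
    by (simp add: lin_ext_superset[of "Poly_Mapping.keys x"] scale_sum)
qed

lemma lin_ext_single [simp]: "lin_ext F (Poly_Mapping.single k c) = scale c (F k)"
  by (simp add: lin_ext_superset[of "{k}"])

lemma lin_ext_mon [simp]: "lin_ext F (mon I) = F I"
  by (simp add: mon_def)

lemma lookup_lin_ext:
  "Poly_Mapping.lookup (lin_ext F x) l =
     (\<Sum>k\<in>Poly_Mapping.keys x. Poly_Mapping.lookup x k * Poly_Mapping.lookup (F k) l)"
  by (simp add: lin_ext_def lookup_sum)

lemma lin_ext_singles: "lin_ext (\<lambda>k. Poly_Mapping.single k 1) x = x"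
proof (rule poly_mapping_eqI)
  fix l
  show "Poly_Mapping.lookup (lin_ext (\<lambda>k. Poly_Mapping.single k 1) x) l = Poly_Mapping.lookup x l"
    by (simp add: lookup_lin_ext lookup_single when_def if_distrib[of "(*) _"] in_keys_iff
        cong: if_cong)
qed

lemma complex_linear_expand:
  "complex_linear f \<Longrightarrow>
     f x = (\<Sum>k\<in>Poly_Mapping.keys x. scale (Poly_Mapping.lookup x k) (f (Poly_Mapping.single k 1)))"
  by (subst lin_ext_singles[of x, symmetric])
    (simp add: lin_ext_def complex_linear_sum complex_linear_scale del: scale_single)

lemma complex_linear_eqI:
  assumes "complex_linear f" "complex_linear h"
    and "\<And>k. f (Poly_Mapping.single k 1) = h (Poly_Mapping.single k 1)"
  shows "f = h"
proof
  fix x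
  show "f x = h x"
    using assms(3) complex_linear_expand[OF assms(1), of x] complex_linear_expand[OF assms(2), of x]
    by simp
qed

subsection \<open>Multi-indices and the coproduct\<close>

lemma exps_mi: "i1 \<le> 1 \<Longrightarrow> 1 \<le> i1 + i2 + i3 \<Longrightarrow> exps (mi i1 i2 i3) = (i1, i2, i3)"
  by (rule Abs_multi_index_inverse) simp

lemma exps_valid: "exps I = (i1, i2, i3) \<Longrightarrow> i1 \<le> 1 \<and> 1 \<le> i1 + i2 + i3"
  using exps[of I] by simp

lemma multi_index_cases:
  obtains i1 i2 i3 where "I = mi i1 i2 i3" "i1 \<le> 1" "1 \<le> i1 + i2 + i3" "exps I = (i1, i2, i3)"
proof -
  obtain i1 i2 i3 where "exps I = (i1, i2, i3)" by (cases "exps I")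
  with exps_valid[OF this] that show ?thesis by (metis exps_inverse)
qed

lemma mi_eq_iff: "i1 \<le> 1 \<Longrightarrow> 1 \<le> i1 + i2 + i3 \<Longrightarrow> mi i1 i2 i3 = J \<longleftrightarrow> exps J = (i1, i2, i3)"
  by (metis exps_inverse exps_mi)

lemma lookup_mon: "Poly_Mapping.lookup (mon I) J = (if I = J then 1 else 0)"
  by (simp add: mon_def lookup_single when_def)

lemma keys_mon [simp]: "Poly_Mapping.keys (mon I) = {I}"
  by (simp add: mon_def)

lemma lookup_tensor:
  "Poly_Mapping.lookup (tensor x y) (J, K) = Poly_Mapping.lookup x J * Poly_Mapping.lookup y K"
proof -
  have "Poly_Mapping.lookup (tensor x y) (J, K) = 
      (\<Sum>J'\<in>Poly_Mapping.keys x. \<Sum>K'\<in>Poly_Mapping.keys y.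
        if J' = J then if K' = K then Poly_Mapping.lookup x J' * Poly_Mapping.lookup y K' else 0 else 0)"
    by (auto simp: tensor_def lookup_sum lookup_single when_def intro!: sum.cong)
  also have "\<dots> = (\<Sum>J'\<in>Poly_Mapping.keys x. if J' = J then (\<Sum>K'\<in>Poly_Mapping.keys y.
        if K' = K then Poly_Mapping.lookup x J' * Poly_Mapping.lookup y K' else 0) else 0)"
    by (intro sum.cong) auto
  also have "\<dots> = Poly_Mapping.lookup x J * Poly_Mapping.lookup y K"
    by (auto simp: in_keys_iff)
  finally show ?thesis .
qed

lemma tensor_sum_left: "tensor (\<Sum>i\<in>A. f i) y = (\<Sum>i\<in>A. tensor (f i) y)"
  by (rule poly_mapping_eqI) (auto simp: lookup_tensor lookup_sum sum_distrib_right)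

lemma tensor_sum_right: "tensor x (\<Sum>i\<in>A. f i) = (\<Sum>i\<in>A. tensor x (f i))"
  by (rule poly_mapping_eqI) (auto simp: lookup_tensor lookup_sum sum_distrib_left)

lemma tensor_scale_left: "tensor (scale c x) y = scale c (tensor x y)"
  and tensor_scale_right: "tensor x (scale c y) = scale c (tensor x y)"
  by (rule poly_mapping_eqI, auto simp: lookup_tensor)+

lemma complex_linear_coproduct: "complex_linear coproduct"
  unfolding coproduct_def by (rule complex_linear_lin_ext)

lemma complex_linear_tensor_map: "complex_linear (tensor_map f q h)"
  unfolding tensor_map_def by (rule complex_linear_lin_ext)

lemma complex_linear_proj_W: "complex_linear proj_W"
  unfolding proj_W_def by (rule complex_linear_lin_ext)

lemma coproduct_mon:
  "coproduct (mon I) =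
     (\<Sum>(J, K)\<in>splits I. Poly_Mapping.single (J, K) (of_nat (multi_choose I J)))"
  by (simp add: coproduct_def)

lemma lookup_coproduct_mon:
  "Poly_Mapping.lookup (coproduct (mon I)) (J, K) =
     (if exps J + exps K = exps I then of_nat (multi_choose I J) else 0)"
proof -
  have "Poly_Mapping.lookup (coproduct (mon I)) (J, K) =
      (\<Sum>z\<in>splits I. if z = (J, K) then of_nat (multi_choose I J) else 0)"
    by (auto simp: coproduct_mon lookup_sum lookup_single when_def intro!: sum.cong)
  then show ?thesis
    by (simp add: finite_splits) (simp add: splits_def)
qed

lemma lookup_coproduct_expand:
  "Poly_Mapping.lookup (coproduct x) (J, K) =
     (\<Sum>I\<in>Poly_Mapping.keys x. Poly_Mapping.lookup x I * Poly_Mapping.lookup (coproduct (mon I)) (J, K))"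
  by (subst complex_linear_expand[OF complex_linear_coproduct])
    (simp add: lookup_sum flip: mon_def)

text \<open>Injectivity of \<open>exps\<close> leaves a single monomial that can produce the pair
  \<open>(J, K)\<close>, so the sum over the keys of \<open>x\<close> collapses.\<close>

lemma lookup_coproduct:
  assumes "exps J + exps K = exps I"
  shows "Poly_Mapping.lookup (coproduct x) (J, K) = of_nat (multi_choose I J) * Poly_Mapping.lookup x I"
proof -
  have "Poly_Mapping.lookup (coproduct x) (J, K) =
     (\<Sum>L\<in>Poly_Mapping.keys x. if L = I then of_nat (multi_choose I J) * Poly_Mapping.lookup x I else 0)"
    by (subst lookup_coproduct_expand, intro sum.cong)
      (auto simp: lookup_coproduct_mon assms exps_inject)
  then show ?thesis by (auto simp: in_keys_iff)
qed

text \<open>This is the case in which \<open>J\<close> and \<open>K\<close> both contain w_1; no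
  monomial splits that way because w_1^2 = 0.\<close>

lemma lookup_coproduct_undefined:
  assumes "\<And>I. exps J + exps K \<noteq> exps I"
  shows "Poly_Mapping.lookup (coproduct x) (J, K) = 0"
  by (subst lookup_coproduct_expand) (simp add: lookup_coproduct_mon assms)

lemma total_degree_ge_1: "total_degree I \<ge> 1"
  by (cases I rule: multi_index_cases) (simp add: total_degree_def)

lemma parity_le_1: "parity I \<le> 1"
  by (cases I rule: multi_index_cases) (simp add: parity_def)

lemma total_degree_splits:
  "(J, K) \<in> splits I \<Longrightarrow> total_degree J + total_degree K = total_degree I"
  by (cases "exps I"; cases "exps J"; cases "exps K") (auto simp: splits_def total_degree_def)

lemma total_degree_splits_less:
  assumes "(J, K) \<in> splits I"
  shows "total_degree J < total_degree I" "total_degree K < total_degree I"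
  using total_degree_splits[OF assms] total_degree_ge_1[of J] total_degree_ge_1[of K] by auto

text \<open>One generator is split off: w_1 if it occurs, otherwise w_2, otherwise w_3. Degree at
  least two guarantees that the cofactor is not constant.\<close>

lemma splits_nonempty:
  assumes "total_degree I \<noteq> 1"
  obtains J K where "(J, K) \<in> splits I" "multi_choose I J \<noteq> 0"
proof -
  obtain i1 i2 i3 where I: "exps I = (i1, i2, i3)" "i1 \<le> 1" "1 \<le> i1 + i2 + i3"
    by (cases I rule: multi_index_cases)
  consider "i1 = 1" "1 \<le> i2 + i3" | "i1 = 0" "1 \<le> i2" "1 \<le> i2 - 1 + i3"
    | "i1 = 0" "i2 = 0" "2 \<le> i3"
    using assms I unfolding total_degree_def by force
  then show ?thesis
  proof cases
    case 1
    then show ?thesis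
      using I by (intro that[of "mi 1 0 0" "mi 0 i2 i3"]) (auto simp: splits_def exps_mi multi_choose_def)
  next
    case 2
    then show ?thesis
      using I by (intro that[of "mi 0 1 0" "mi 0 (i2 - 1) i3"])
        (auto simp: splits_def exps_mi multi_choose_def)
  next
    case 3
    then show ?thesis
      using I by (intro that[of "mi 0 0 1" "mi 0 0 (i3 - 1)"])
        (auto simp: splits_def exps_mi multi_choose_def)
  qed
qed

lemma lookup_proj_W:
  "Poly_Mapping.lookup (proj_W x) I = (if total_degree I = 1 then Poly_Mapping.lookup x I else 0)"
proof -
  have "Poly_Mapping.lookup (proj_W x) I = (\<Sum>J\<in>Poly_Mapping.keys x.
     if J = I then if total_degree I = 1 then Poly_Mapping.lookup x I else 0 else 0)"
    unfolding proj_W_def lookup_lin_ext by (intro sum.cong) (auto simp: lookup_mon)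
  then show ?thesis by (auto simp: in_keys_iff)
qed

lemma proj_W_mon: "proj_W (mon I) = (if total_degree I = 1 then mon I else 0)"
  by (simp add: proj_W_def)

text \<open>The binomial coefficients are nonzero in characteristic zero, so the coproduct loses no
  information outside \<open>W\<close>; in particular primitive elements lie in
  \<open>W\<close>.\<close>

lemma coproduct_determines:
  assumes "coproduct x = coproduct y" and "total_degree I \<noteq> 1"
  shows "Poly_Mapping.lookup x I = Poly_Mapping.lookup y I"
proof -
  obtain J K where JK: "(J, K) \<in> splits I" "multi_choose I J \<noteq> 0"
    by (rule splits_nonempty[OF assms(2)])
  then have split: "exps J + exps K = exps I"
    by (simp add: splits_def)
  have "of_nat (multi_choose I J) * Poly_Mapping.lookup x I =
      (of_nat (multi_choose I J) :: complex) * Poly_Mapping.lookup y I"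
    unfolding lookup_coproduct[OF split, symmetric] assms(1) ..
  then show ?thesis
    using JK(2) by (simp only: mult_cancel_left of_nat_eq_0_iff simp_thms)
qed

text \<open>The common form of cofreeness: it yields the uniqueness of coderivations, of coalgebra
  morphisms and of coderivations along a coalgebra morphism with given corestriction to \<open>W\<close>.\<close>

lemma corestriction_unique:
  assumes lin: "complex_linear f" "complex_linear h"
    and proj: "\<And>I. proj_W (f (mon I)) = proj_W (h (mon I))"
    and step: "\<And>I. (\<And>J K. (J, K) \<in> splits I \<Longrightarrow> f (mon J) = h (mon J) \<and> f (mon K) = h (mon K)) \<Longrightarrow>
      coproduct (f (mon I)) = coproduct (h (mon I))"
  shows "f = h"
proof (rule complex_linear_eqI[OF lin], fold mon_def)
  fix I
  show "f (mon I) = h (mon I)"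
  \<comment> \<open>Both factors of a split are nonconstant, hence of smaller degree, so the
    induction hypothesis supplies the premise of \<open>step\<close>.\<close>
  proof (induction "total_degree I" arbitrary: I rule: less_induct)
    case less
    have "coproduct (f (mon I)) = coproduct (h (mon I))"
    proof (intro step conjI)
      fix J K assume "(J, K) \<in> splits I"
      then show "f (mon J) = h (mon J)" and "f (mon K) = h (mon K)"
        using less total_degree_splits_less by auto
    qed
    moreover have "Poly_Mapping.lookup (f (mon I)) L = Poly_Mapping.lookup (h (mon I)) L"
      if "total_degree L = 1" for L
      using lookup_proj_W[of "f (mon I)" L] lookup_proj_W[of "h (mon I)" L] proj[of I] that by simp
    ultimately show ?case
      by (intro poly_mapping_eqI) (blast intro: coproduct_determines)
  qed
qed

section \<open>Tensor products of maps and Koszul signs\<close>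

lemma tensor_map_single:
  "tensor_map f q h (Poly_Mapping.single (J, K) c) =
     scale (c * (-1) ^ (q * parity J)) (tensor (f (mon J)) (h (mon K)))"
  by (simp add: tensor_map_def)

lemma tensor_map_coproduct_mon:
  "tensor_map f q h (coproduct (mon I)) =
     (\<Sum>(J, K)\<in>splits I. scale (of_nat (multi_choose I J) * (-1) ^ (q * parity J))
        (tensor (f (mon J)) (h (mon K))))"
  by (auto simp: coproduct_mon complex_linear_sum[OF complex_linear_tensor_map] tensor_map_single
      intro!: sum.cong)

text \<open>For odd \<open>q\<close> the Koszul sign varies with the parity of the monomials of
  \<open>x\<close>; the parity hypothesis makes it constant, so it can leave the sum.\<close>

lemma tensor_map_tensor:
  assumes "complex_linear f" "complex_linear h"
    and par: "\<And>J. J \<in> Poly_Mapping.keys x \<Longrightarrow> even (n + q * parity J)"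
  shows "tensor_map f q h (tensor x y) = scale ((-1) ^ n) (tensor (f x) (h y))"
proof -
  have sign: "(-1 :: complex) ^ (q * parity J) = (-1) ^ n" if "J \<in> Poly_Mapping.keys x" for J
    using par[OF that] by (auto simp: minus_one_power_iff)
  have "tensor_map f q h (tensor x y) =
    (\<Sum>J\<in>Poly_Mapping.keys x. \<Sum>K\<in>Poly_Mapping.keys y.
       scale (Poly_Mapping.lookup x J * Poly_Mapping.lookup y K * (-1) ^ n)
         (tensor (f (mon J)) (h (mon K))))"
    by (simp add: tensor_def complex_linear_sum[OF complex_linear_tensor_map] tensor_map_single sign)
  also have "\<dots> = scale ((-1) ^ n) (tensor (f x) (h y))"
    by (subst complex_linear_expand[OF assms(1), of x], subst complex_linear_expand[OF assms(2), of y],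
        simp add: tensor_sum_left tensor_sum_right tensor_scale_left tensor_scale_right scale_sum
          ac_simps flip: mon_def)
      (rule sum.swap)
  finally show ?thesis .
qed

text \<open>The graded interchange law has the sign (-1)^(|h||g|). It is trivial when
  \<open>h\<close> is even (\<open>q = 0\<close>) or \<open>g\<close> is even.\<close>

lemma tensor_map_comp:
  assumes "complex_linear f" "complex_linear h" and par: "q = 0 \<or> map_parity 0 g"
  shows "tensor_map f q h (tensor_map g q' k t) = tensor_map (f \<circ> g) (q + q') (h \<circ> k) t"
proof -
  have "tensor_map f q h \<circ> tensor_map g q' k = tensor_map (f \<circ> g) (q + q') (h \<circ> k)"
  proof (rule complex_linear_eqI)
    fix z :: "multi_index \<times> multi_index"
    obtain J K where z: "z = (J, K)" by (cases z)
    have "tensor_map f q h (tensor (g (mon J)) (k (mon K))) =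
        scale ((-1) ^ (q * parity J)) (tensor (f (g (mon J))) (h (k (mon K))))"
      using par by (intro tensor_map_tensor assms(1,2)) (auto simp: map_parity_def)
    then show "(tensor_map f q h \<circ> tensor_map g q' k) (Poly_Mapping.single z 1) =
        tensor_map (f \<circ> g) (q + q') (h \<circ> k) (Poly_Mapping.single z 1)"
      by (simp add: z tensor_map_single complex_linear_scale[OF complex_linear_tensor_map]
          algebra_simps flip: power_add)
  qed (intro complex_linear_comp complex_linear_tensor_map)+
  then show ?thesis by (metis comp_apply)
qed

lemma tensor_map_coproduct_cong:
  assumes "\<And>J K. (J, K) \<in> splits I \<Longrightarrow> f (mon J) = f' (mon J) \<and> h (mon K) = h' (mon K)"
  shows "tensor_map f q h (coproduct (mon I)) = tensor_map f' q h' (coproduct (mon I))"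
  unfolding tensor_map_coproduct_mon by (intro sum.cong) (auto simp: assms)

lemma lookup_tensor_map_coproduct_mon:
  "Poly_Mapping.lookup (tensor_map f q h (coproduct (mon I))) (J, K) =
     (\<Sum>(P, Q)\<in>splits I. of_nat (multi_choose I P) * (-1) ^ (q * parity P) *
        (Poly_Mapping.lookup (f (mon P)) J * Poly_Mapping.lookup (h (mon Q)) K))"
  by (auto simp: tensor_map_coproduct_mon lookup_sum lookup_tensor intro!: sum.cong)

subsection \<open>Coalgebra morphisms and coderivations\<close>

text \<open>Comultiplicativity is isolated from bijectivity, so that uniqueness of morphisms can
  itself be used to prove that substitutions are invertible.\<close>

definition coalgebra_hom :: "(SW \<Rightarrow> SW) \<Rightarrow> bool" where
  "coalgebra_hom g \<longleftrightarrow> complex_linear g \<and> (\<forall>x. coproduct (g x) = tensor_map g 0 g (coproduct x))"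

lemma coalgebra_homD:
  assumes "coalgebra_hom g"
  shows "complex_linear g" "coproduct (g x) = tensor_map g 0 g (coproduct x)"
  using assms by (auto simp: coalgebra_hom_def)

lemma coalgebra_homI:
  assumes lin: "complex_linear g"
    and mon: "\<And>I. coproduct (g (mon I)) = tensor_map g 0 g (coproduct (mon I))"
  shows "coalgebra_hom g"
proof -
  have "coproduct \<circ> g = tensor_map g 0 g \<circ> coproduct"
    by (rule complex_linear_eqI)
      (simp_all add: mon lin complex_linear_comp complex_linear_coproduct complex_linear_tensor_map
        flip: mon_def)
  then show ?thesis using lin by (auto simp: coalgebra_hom_def fun_eq_iff)
qed

lemma coalgebra_hom_id: "coalgebra_hom id"
proof (rule coalgebra_homI[OF complex_linear_id])
  fix I
  have "tensor (mon J) (mon K) = Poly_Mapping.single (J, K) 1" for J K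
    by (simp add: tensor_def lookup_mon)
  then show "coproduct (id (mon I)) = tensor_map id 0 id (coproduct (mon I))"
    by (simp add: tensor_map_coproduct_mon) (simp add: coproduct_mon)
qed

lemma coalgebra_hom_comp:
  assumes f: "coalgebra_hom f" and g: "coalgebra_hom g"
  shows "coalgebra_hom (f \<circ> g)"
  using coalgebra_homD[OF f] coalgebra_homD[OF g]
  by (auto simp: coalgebra_hom_def complex_linear_comp tensor_map_comp)

lemma coalgebra_hom_eqI:
  assumes f: "coalgebra_hom f" and h: "coalgebra_hom h"
    and "\<And>I. proj_W (f (mon I)) = proj_W (h (mon I))"
  shows "f = h"
proof (rule corestriction_unique)
  fix I
  assume *: "\<And>J K. (J, K) \<in> splits I \<Longrightarrow> f (mon J) = h (mon J) \<and> f (mon K) = h (mon K)"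
  show "coproduct (f (mon I)) = coproduct (h (mon I))"
    unfolding coalgebra_homD(2)[OF f] coalgebra_homD(2)[OF h]
    by (rule tensor_map_coproduct_cong) (use * in blast)
qed (use assms coalgebra_homD in blast)+

text \<open>The dual of a derivation along a ring homomorphism. For coderivations \<open>D\<close>,
  \<open>E\<close> and an even morphism \<open>g\<close>, both \<open>D \<circ> g\<close> and
  \<open>g \<circ> E\<close> are of this kind, which lets them be compared by corestriction.\<close>

definition coderivation_along :: "(SW \<Rightarrow> SW) \<Rightarrow> nat \<Rightarrow> (SW \<Rightarrow> SW) \<Rightarrow> bool" where
  "coderivation_along g p D \<longleftrightarrow> complex_linear D \<and>
     (\<forall>x. coproduct (D x) = tensor_map D 0 g (coproduct x) + tensor_map g p D (coproduct x))"

lemma coderivation_iff: "coderivation p D \<longleftrightarrow> coderivation_along id p D \<and> map_parity p D"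
  by (auto simp: coderivation_def coderivation_along_def)

lemma coderivation_along_eqI:
  assumes D: "coderivation_along g p D" and E: "coderivation_along g p E"
    and "\<And>I. proj_W (D (mon I)) = proj_W (E (mon I))"
  shows "D = E"
proof (rule corestriction_unique)
  fix I
  assume "\<And>J K. (J, K) \<in> splits I \<Longrightarrow> D (mon J) = E (mon J) \<and> D (mon K) = E (mon K)"
  then have "tensor_map D 0 g (coproduct (mon I)) = tensor_map E 0 g (coproduct (mon I))"
    "tensor_map g p D (coproduct (mon I)) = tensor_map g p E (coproduct (mon I))"
    by (auto intro!: tensor_map_coproduct_cong)
  then show "coproduct (D (mon I)) = coproduct (E (mon I))"
    using D E by (simp add: coderivation_along_def)
qed (use assms coderivation_along_def in blast)+

lemma coder_eqI:
  assumes D: "coderivation p D" and proj: "proj_W \<circ> D = d"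
  shows "coder p d = D"
  unfolding coder_def
proof (rule the_equality)
  fix E
  assume E: "coderivation p E \<and> proj_W \<circ> E = d"
  show "E = D"
  proof (rule coderivation_along_eqI)
    show "proj_W (E (mon I)) = proj_W (D (mon I))" for I
      using E proj by (metis comp_apply)
  qed (use D E in \<open>auto simp: coderivation_iff\<close>)
qed (use assms in blast)

text \<open>Evenness of \<open>g\<close> lets \<open>D\<close> move past it in (id \<otimes> D)(g
  \<otimes> g) without a sign.\<close>

lemma coderivation_comp_hom:
  assumes "coderivation p D" "coalgebra_hom g" "map_parity 0 g"
  shows "coderivation_along g p (D \<circ> g)"
  using assms
  by (auto simp: coderivation_def coderivation_along_def coalgebra_hom_def complex_linear_comp
      tensor_map_comp complex_linear_id)

lemma hom_comp_coderivation:
  assumes "coderivation p D" "coalgebra_hom g"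
  shows "coderivation_along g p (g \<circ> D)"
  using assms
  by (auto simp: coderivation_def coderivation_along_def coalgebra_hom_def complex_linear_comp
      tensor_map_comp complex_linear_add[OF complex_linear_tensor_map])

lemma tensor_map_add:
  "tensor_map (\<lambda>x. D x + E x) q h t = tensor_map D q h t + tensor_map E q h t"
  "tensor_map h q (\<lambda>x. D x + E x) t = tensor_map h q D t + tensor_map h q E t"
  by (rule poly_mapping_eqI,
      auto simp: tensor_map_def lin_ext_def lookup_sum lookup_add lookup_tensor algebra_simps
      case_prod_unfold sum.distrib)+

lemma tensor_map_scale:
  "tensor_map (\<lambda>x. scale c (D x)) q h t = scale c (tensor_map D q h t)"
  "tensor_map h q (\<lambda>x. scale c (D x)) t = scale c (tensor_map h q D t)"
  by (simp_all add: tensor_map_def lin_ext_def case_prod_unfold tensor_scale_left tensor_scale_right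
      scale_sum mult.left_commute mult.commute)

lemma map_parity_plus: "map_parity p D \<Longrightarrow> map_parity p E \<Longrightarrow> map_parity p (\<lambda>x. D x + E x)"
  by (auto simp: map_parity_def dest!: subsetD[OF Poly_Mapping.keys_add])

lemma map_parity_scale: "map_parity p D \<Longrightarrow> map_parity p (\<lambda>x. scale c (D x))"
  by (auto simp: map_parity_def in_keys_iff)

lemma coderivation_add:
  "coderivation p D \<Longrightarrow> coderivation p E \<Longrightarrow> coderivation p (\<lambda>x. D x + E x)"
  by (simp add: coderivation_def complex_linear_plus map_parity_plus tensor_map_add
      complex_linear_add[OF complex_linear_coproduct])

lemma coderivation_scale: "coderivation p D \<Longrightarrow> coderivation p (\<lambda>x. scale c (D x))"
  by (simp add: coderivation_def complex_linear_scale_fun map_parity_scale tensor_map_scale scale_add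
      complex_linear_scale[OF complex_linear_coproduct])

subsection \<open>The coderivations of the second kind\<close>

text \<open>The differential operator $w_1\,\partial_2^{s_2}\partial_3^{s_3}$.  It is a coderivation because
  constant coefficient operators commute with the coproduct of the polynomial Hopf algebra and
  $w_1$ is primitive; the Koszul sign accounts for $w_1^2 = 0$.\<close>

definition diff_op :: "nat \<Rightarrow> nat \<Rightarrow> SW \<Rightarrow> SW" where
  "diff_op s2 s3 = lin_ext (\<lambda>I. case exps I of (i1, i2, i3) \<Rightarrow>
     if i1 = 0 \<and> s2 \<le> i2 \<and> s3 \<le> i3
     then scale (fact i2 / fact (i2 - s2) * (fact i3 / fact (i3 - s3))) (mon (mi 1 (i2 - s2) (i3 - s3)))
     else 0)"

lemma lookup_diff_op_mon:
  assumes "exps J = (j1, j2, j3)"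
  shows "Poly_Mapping.lookup (diff_op s2 s3 (mon I)) J =
    (if j1 = 1 \<and> exps I = (0, j2 + s2, j3 + s3)
     then fact (j2 + s2) / fact j2 * (fact (j3 + s3) / fact j3) else 0)"
proof -
  obtain i1 i2 i3 where I: "exps I = (i1, i2, i3)" by (cases "exps I")
  have eq: "mi (Suc 0) m n = J \<longleftrightarrow> j1 = 1 \<and> m = j2 \<and> n = j3" for m n
    by (auto simp: mi_eq_iff assms)
  show ?thesis
    by (auto simp: diff_op_def I lookup_mon eq)
qed

lemma choose_fact: "of_nat ((m + n) choose m) = (fact (m + n) / (fact m * fact n) :: complex)"
  using binomial_fact[of m "m + n"] by simp

lemma coderivation_diff_op:
  assumes "1 \<le> s2 + s3"
  shows "coderivation 1 (diff_op s2 s3)"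
proof -
  let ?D = "diff_op s2 s3"
  have lin: "complex_linear ?D"
    unfolding diff_op_def by (rule complex_linear_lin_ext)
  have par: "map_parity 1 ?D"
    unfolding map_parity_def
  proof (intro allI ballI)
    fix I J
    assume "J \<in> Poly_Mapping.keys (?D (mon I))"
    moreover obtain j1 j2 j3 where J: "exps J = (j1, j2, j3)" by (cases "exps J")
    ultimately show "even (parity I + parity J + 1)"
      by (auto simp: in_keys_iff lookup_diff_op_mon[OF J] parity_def J split: if_splits)
  qed
  have "coproduct (?D (mon I)) =
      tensor_map ?D 0 id (coproduct (mon I)) + tensor_map id 1 ?D (coproduct (mon I))" for I
  proof (rule poly_mapping_eqI)
    fix z :: "multi_index \<times> multi_index"
    obtain J K where z: "z = (J, K)" by (cases z)
    obtain j1 j2 j3 where J: "exps J = (j1, j2, j3)" by (cases "exps J")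
    obtain k1 k2 k3 where K: "exps K = (k1, k2, k3)" by (cases "exps K")
    note Jv = exps_valid[OF J] and Kv = exps_valid[OF K]
    \<comment> \<open>The common coefficient of all three terms: the factorials of the
      differentiated exponents cancel between the binomials and the derivative, leaving an
      expression symmetric in \<open>J\<close> and \<open>K\<close>.\<close>
    define v :: complex where "v = fact (j2 + s2 + k2) * fact (j3 + s3 + k3) /
      (fact j2 * fact j3 * fact k2 * fact k3)"
    have left: "Poly_Mapping.lookup (tensor_map ?D 0 id (coproduct (mon I))) (J, K) =
        (if j1 = 1 \<and> exps I = (k1, j2 + s2 + k2, j3 + s3 + k3) then v else 0)"
    proof -
      \<comment> \<open>Positive order of the operator makes this index admissible even when
        \<open>J\<close> is w_1 alone.\<close>
      have ex: "exps (mi 0 (j2 + s2) (j3 + s3)) = (0, j2 + s2, j3 + s3)"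
        using assms by (simp add: exps_mi)
      have eq: "exps P = (0, j2 + s2, j3 + s3) \<longleftrightarrow> P = mi 0 (j2 + s2) (j3 + s3)" for P
        using assms mi_eq_iff[of 0 "j2 + s2" "j3 + s3" P] by auto
      \<comment> \<open>Only one split contributes: its second factor is \<open>K\<close>, and its
        first is the unique monomial that the operator sends to a multiple of w_J.\<close>
      have "Poly_Mapping.lookup (tensor_map ?D 0 id (coproduct (mon I))) (J, K) =
        (\<Sum>w\<in>splits I. if w = (mi 0 (j2 + s2) (j3 + s3), K) then
          (if j1 = 1 \<and> exps I = (k1, j2 + s2 + k2, j3 + s3 + k3) then v else 0) else 0)"
        unfolding lookup_tensor_map_coproduct_mon
      proof (intro sum.cong refl, clarify)
        fix P Q
        assume PQ: "(P, Q) \<in> splits I"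
        show "of_nat (multi_choose I P) * (-1) ^ (0 * parity P) *
            (Poly_Mapping.lookup (?D (mon P)) J * Poly_Mapping.lookup (id (mon Q)) K) =
          (if (P, Q) = (mi 0 (j2 + s2) (j3 + s3), K) then
            (if j1 = 1 \<and> exps I = (k1, j2 + s2 + k2, j3 + s3 + k3) then v else 0) else 0)"
        proof (cases "P = mi 0 (j2 + s2) (j3 + s3) \<and> Q = K \<and> j1 = 1")
          case True
          then have I: "exps I = (k1, j2 + s2 + k2, j3 + s3 + k3)"
            using PQ by (auto simp: splits_def ex K)
          show ?thesis
            using True by (simp add: lookup_diff_op_mon[OF J] lookup_mon ex I multi_choose_def
                choose_fact v_def)
        qed (auto simp: lookup_diff_op_mon[OF J] lookup_mon eq)
      qed
      also have "\<dots> = (if j1 = 1 \<and> exps I = (k1, j2 + s2 + k2, j3 + s3 + k3) then v else 0)"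
        by (auto simp: finite_splits) (auto simp: splits_def ex K)
      finally show ?thesis .
    qed
    have right: "Poly_Mapping.lookup (tensor_map id 1 ?D (coproduct (mon I))) (J, K) =
        (if k1 = 1 \<and> exps I = (j1, j2 + s2 + k2, j3 + s3 + k3) then (-1) ^ j1 * v else 0)"
    proof -
      have ex: "exps (mi 0 (k2 + s2) (k3 + s3)) = (0, k2 + s2, k3 + s3)"
        using assms by (simp add: exps_mi)
      have eq: "exps P = (0, k2 + s2, k3 + s3) \<longleftrightarrow> P = mi 0 (k2 + s2) (k3 + s3)" for P
        using assms mi_eq_iff[of 0 "k2 + s2" "k3 + s3" P] by auto
      have "Poly_Mapping.lookup (tensor_map id 1 ?D (coproduct (mon I))) (J, K) =
        (\<Sum>w\<in>splits I. if w = (J, mi 0 (k2 + s2) (k3 + s3)) then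
          (if k1 = 1 \<and> exps I = (j1, j2 + s2 + k2, j3 + s3 + k3) then (-1) ^ j1 * v else 0) else 0)"
        unfolding lookup_tensor_map_coproduct_mon
      proof (intro sum.cong refl, clarify)
        fix P Q
        assume PQ: "(P, Q) \<in> splits I"
        show "of_nat (multi_choose I P) * (-1) ^ (1 * parity P) *
            (Poly_Mapping.lookup (id (mon P)) J * Poly_Mapping.lookup (?D (mon Q)) K) =
          (if (P, Q) = (J, mi 0 (k2 + s2) (k3 + s3)) then
            (if k1 = 1 \<and> exps I = (j1, j2 + s2 + k2, j3 + s3 + k3) then (-1) ^ j1 * v else 0) else 0)"
        proof (cases "P = J \<and> Q = mi 0 (k2 + s2) (k3 + s3) \<and> k1 = 1")
          case True
          then have I: "exps I = (j1, j2 + (k2 + s2), j3 + (k3 + s3))"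
            using PQ by (auto simp: splits_def ex J)
          show ?thesis
            using True by (simp add: lookup_diff_op_mon[OF K] lookup_mon ex I J multi_choose_def
                choose_fact parity_def v_def) (simp add: ac_simps)
        qed (auto simp: lookup_diff_op_mon[OF K] lookup_mon eq)
      qed
      also have "\<dots> = (if k1 = 1 \<and> exps I = (j1, j2 + s2 + k2, j3 + s3 + k3) then (-1) ^ j1 * v else 0)"
        by (auto simp: finite_splits) (auto simp: splits_def ex J)
      finally show ?thesis .
    qed
    have "Poly_Mapping.lookup (coproduct (?D (mon I))) (J, K) =
        (if j1 + k1 = 1 \<and> exps I = (0, j2 + s2 + k2, j3 + s3 + k3) then v else 0)"
    proof (cases "j1 + k1 \<le> 1")
      case True
      obtain L where L: "exps L = (j1 + k1, j2 + k2, j3 + k3)"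
        using True Jv by (intro that[OF exps_mi]) auto
      have "of_nat (multi_choose L J) * (fact (j2 + k2 + s2) / fact (j2 + k2) *
          (fact (j3 + k3 + s3) / fact (j3 + k3))) = v" if "j1 + k1 = 1"
        using that by (cases j1) (auto simp: multi_choose_def L J choose_fact v_def ac_simps)
      then show ?thesis
        using lookup_coproduct[of J K L] by (auto simp: L J K lookup_diff_op_mon[OF L] ac_simps)
    next
      case False
      then have "exps J + exps K \<noteq> exps L" for L
        using exps_valid by (cases "exps L") (fastforce simp: J K)
      then show ?thesis
        using False by (simp add: lookup_coproduct_undefined)
    qed
    \<comment> \<open>For \<open>j1 = k1 = 1\<close> the two terms on the right are \<open>v\<close>
      and \<open>- v\<close>; their cancellation matches w_1^2 = 0 on the left.\<close>
    moreover have "j1 = 0 \<or> j1 = 1" "k1 = 0 \<or> k1 = 1"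
      using Jv Kv by auto
    ultimately show "Poly_Mapping.lookup (coproduct (?D (mon I))) z = Poly_Mapping.lookup
        (tensor_map ?D 0 id (coproduct (mon I)) + tensor_map id 1 ?D (coproduct (mon I))) z"
      unfolding z lookup_add left right by (elim disjE) auto
  qed
  then have "coproduct \<circ> ?D =
      (\<lambda>x. (tensor_map ?D 0 id \<circ> coproduct) x + (tensor_map id 1 ?D \<circ> coproduct) x)"
    by (intro complex_linear_eqI complex_linear_plus complex_linear_comp lin complex_linear_coproduct
        complex_linear_tensor_map) (simp flip: mon_def)
  then show ?thesis
    using lin par by (auto simp: coderivation_def fun_eq_iff)
qed

definition quad_coder :: "complex \<Rightarrow> complex \<Rightarrow> complex \<Rightarrow> SW \<Rightarrow> SW" where
  "quad_coder a b c =
     (\<lambda>x. scale a (diff_op 2 0 x) + scale b (diff_op 1 1 x) + scale c (diff_op 0 2 x))"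

lemma coderivation_quad_coder: "coderivation 1 (quad_coder a b c)"
  unfolding quad_coder_def
  by (intro coderivation_add coderivation_scale coderivation_diff_op) simp_all

lemma complex_linear_quad_coder: "complex_linear (quad_coder a b c)"
  using coderivation_quad_coder by (simp add: coderivation_def)

lemma complex_linear_phi: "complex_linear (phi I j)"
  unfolding phi_def by (rule complex_linear_lin_ext)

lemma complex_linear_second_kind: "complex_linear (second_kind a b c)"
  unfolding second_kind_def
  by (intro complex_linear_plus complex_linear_scale_fun complex_linear_phi)

text \<open>The output lies in \<open>W\<close> only if every even variable is differentiated away,
  and the full derivative of the monomial gives exactly the factor I! in \<open>phi\<close>.\<close>

lemma proj_W_diff_op:
  assumes "1 \<le> s2 + s3"
  shows "proj_W (diff_op s2 s3 x) = phi (mi 0 s2 s3) B1 x"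
proof -
  have "proj_W \<circ> diff_op s2 s3 = phi (mi 0 s2 s3) B1"
  proof (rule complex_linear_eqI, fold mon_def)
    show "complex_linear (proj_W \<circ> diff_op s2 s3)"
      by (intro complex_linear_comp complex_linear_proj_W) (simp add: diff_op_def complex_linear_lin_ext)
    fix I
    show "(proj_W \<circ> diff_op s2 s3) (mon I) = phi (mi 0 s2 s3) B1 (mon I)"
    proof (rule poly_mapping_eqI)
      fix J
      obtain j1 j2 j3 where J: "exps J = (j1, j2, j3)" by (cases "exps J")
      have ex: "exps (mi 0 s2 s3) = (0, s2, s3)" "exps (mi 1 0 0) = (1, 0, 0)"
        using assms by (simp_all add: exps_mi)
      have eq: "I = mi 0 s2 s3 \<longleftrightarrow> exps I = (0, s2, s3)"
        unfolding eq_commute[of I] using assms by (intro mi_eq_iff) auto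
      have eq': "mi (Suc 0) 0 0 = J \<longleftrightarrow> exps J = (1, 0, 0)"
        by (simp add: mi_eq_iff)
      show "Poly_Mapping.lookup ((proj_W \<circ> diff_op s2 s3) (mon I)) J =
          Poly_Mapping.lookup (phi (mi 0 s2 s3) B1 (mon I)) J"
        by (auto simp: lookup_proj_W lookup_diff_op_mon[OF J] phi_def lookup_mon eq eq' multi_fact_def ex total_degree_def J)
    qed
  qed (rule complex_linear_phi)
  then show ?thesis by (metis comp_apply)
qed

lemma proj_W_quad_coder: "proj_W (quad_coder a b c x) = second_kind a b c x"
  by (simp add: quad_coder_def second_kind_def proj_W_diff_op
      complex_linear_add[OF complex_linear_proj_W] complex_linear_scale[OF complex_linear_proj_W])

lemma coder_second_kind: "coder 1 (second_kind a b c) = quad_coder a b c"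
  by (rule coder_eqI[OF coderivation_quad_coder]) (simp add: fun_eq_iff proj_W_quad_coder)

text \<open>Every monomial in the image contains w_1, and the operator kills all such
  monomials.\<close>

lemma quad_coder_squared: "quad_coder a b c (quad_coder a b c x) = 0"
proof -
  have "quad_coder a b c (quad_coder a b c (mon I)) = 0" for I
  proof -
    have "quad_coder a b c (mon J) = 0" if "J \<in> Poly_Mapping.keys (quad_coder a b c (mon I))" for J
    proof (rule poly_mapping_eqI)
      fix K
      obtain j1 j2 j3 where J: "exps J = (j1, j2, j3)" by (cases "exps J")
      obtain k1 k2 k3 where K: "exps K = (k1, k2, k3)" by (cases "exps K")
      have "j1 = 1"
        using that by (cases "j1 = 1")
          (auto simp: in_keys_iff quad_coder_def lookup_add lookup_diff_op_mon[OF J])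
      then show "Poly_Mapping.lookup (quad_coder a b c (mon J)) K = Poly_Mapping.lookup 0 K"
        by (simp add: quad_coder_def lookup_add lookup_diff_op_mon[OF K] J)
    qed
    then show ?thesis
      by (subst complex_linear_expand[OF complex_linear_quad_coder]) (simp flip: mon_def)
  qed
  then have "quad_coder a b c \<circ> quad_coder a b c = (\<lambda>x. 0)"
    by (intro complex_linear_eqI complex_linear_comp complex_linear_quad_coder)
      (auto simp flip: mon_def intro!: complex_linearI)
  then show ?thesis by (metis comp_apply)
qed

lemma keys_proj_W: "Poly_Mapping.keys (proj_W x) \<subseteq> Poly_Mapping.keys x"
  by (auto simp: in_keys_iff lookup_proj_W split: if_splits)

lemma map_parity_proj_W: "map_parity p D \<Longrightarrow> map_parity p (\<lambda>x. proj_W (D x))"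
  using keys_proj_W unfolding map_parity_def by (meson subsetD)

lemma codifferential_second_kind: "codifferential (second_kind a b c)"
proof -
  have "map_parity 1 (second_kind a b c)"
    using map_parity_proj_W[of 1 "quad_coder a b c"] coderivation_quad_coder[of a b c]
    by (simp add: coderivation_def proj_W_quad_coder)
  moreover have "range (second_kind a b c) \<subseteq> W"
    by (auto simp: W_def in_keys_iff lookup_proj_W simp flip: proj_W_quad_coder split: if_splits)
  ultimately show ?thesis
    by (simp add: codifferential_def cochain_def graded_commutator_def coder_second_kind[unfolded One_nat_def]
        quad_coder_squared complex_linear_second_kind)
qed

subsection \<open>Linear substitutions\<close>

text \<open>The coalgebra morphism induced by $w_1\mapsto w_1$, $w_2\mapsto p w_2+q w_3$,
  $w_3\mapsto r w_2+s w_3$.  In the basis $w_I/I!$ its matrix is the transpose of the substitution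
  $\xi_2\mapsto p\xi_2+r\xi_3$, $\xi_3\mapsto q\xi_2+s\xi_3$ of the dual power series algebra; by
  homogeneity it suffices to record the exponent of \<open>\<xi>\<^sub>3\<close>.  Comultiplicativity thus becomes
  multiplicativity of polynomial substitution.\<close>

definition dual_mon :: "complex \<Rightarrow> complex \<Rightarrow> complex \<Rightarrow> complex \<Rightarrow> nat \<Rightarrow> nat \<Rightarrow> complex poly" where
  "dual_mon p q r s j2 j3 = [:p, r:] ^ j2 * [:q, s:] ^ j3"

definition linear_subst :: "complex \<Rightarrow> complex \<Rightarrow> complex \<Rightarrow> complex \<Rightarrow> SW \<Rightarrow> SW" where
  "linear_subst p q r s = lin_ext (\<lambda>I. case exps I of (i1, i2, i3) \<Rightarrow>
     \<Sum>u\<le>i2 + i3. scale (fact i2 * fact i3 / (fact (i2 + i3 - u) * fact u) *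
       coeff (dual_mon p q r s (i2 + i3 - u) u) i3) (mon (mi i1 (i2 + i3 - u) u)))"

lemma lookup_linear_subst_mon:
  assumes I: "exps I = (i1, i2, i3)" and J: "exps J = (j1, j2, j3)"
  shows "Poly_Mapping.lookup (linear_subst p q r s (mon I)) J =
    (if j1 = i1 \<and> j2 + j3 = i2 + i3
     then fact i2 * fact i3 / (fact j2 * fact j3) * coeff (dual_mon p q r s j2 j3) i3 else 0)"
proof -
  have eq: "mi i1 (i2 + i3 - u) u = J \<longleftrightarrow> j1 = i1 \<and> j2 + j3 = i2 + i3 \<and> u = j3" if "u \<le> i2 + i3" for u
    using that exps_valid[OF I] by (subst mi_eq_iff) (auto simp: J)
  have diff: "i2 + i3 - j3 = j2" if "j2 + j3 = i2 + i3"
    using that by linarith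
  have "Poly_Mapping.lookup (linear_subst p q r s (mon I)) J = (\<Sum>u\<le>i2 + i3.
      if u = j3 then if j1 = i1 \<and> j2 + j3 = i2 + i3
        then fact i2 * fact i3 / (fact j2 * fact j3) * coeff (dual_mon p q r s j2 j3) i3 else 0 else 0)"
    unfolding linear_subst_def lin_ext_mon I prod.case lookup_sum
    by (intro sum.cong refl) (auto simp: lookup_mon eq diff)
  then show ?thesis by auto
qed

lemma complex_linear_linear_subst: "complex_linear (linear_subst p q r s)"
  unfolding linear_subst_def by (rule complex_linear_lin_ext)

text \<open>Recording only the exponent of \<xi>_3 hides the degree of the form; this bound recovers
  it, so that no spurious terms enter the convolution below.\<close>

lemma degree_dual_mon: "degree (dual_mon p q r s j2 j3) \<le> j2 + j3"
proof -
  have "degree ([:x, y:] ^ n) \<le> n" for x y :: complex and n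
    using degree_power_le[of "[:x, y:]" n] by (auto split: if_splits intro: order_trans)
  then show ?thesis
    unfolding dual_mon_def by (intro order_trans[OF degree_mult_le] add_mono)
qed

text \<open>Once parity and degree of the first factor are fixed, a split of \<open>I\<close> is
  determined by its exponent \<open>u\<close> of w_3, and the sum becomes a Cauchy product of
  polynomial coefficients.\<close>

lemma sum_splits_dual_mon:
  assumes I: "exps I = (i1, i2, i3)" and J: "exps J = (j1, j2, j3)" and K: "exps K = (k1, k2, k3)"
    and i1: "i1 = j1 + k1" and deg: "i2 + i3 = j2 + j3 + (k2 + k3)"
  shows "(\<Sum>(P, Q) | (P, Q) \<in> splits I \<and> parity P = j1 \<and> total_degree P = total_degree J.
      coeff (dual_mon p q r s j2 j3) (snd (snd (exps P))) *
      coeff (dual_mon p q r s k2 k3) (snd (snd (exps Q)))) =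
    coeff (dual_mon p q r s (j2 + k2) (j3 + k3)) i3"
proof -
  let ?F = "\<lambda>u. coeff (dual_mon p q r s j2 j3) u * coeff (dual_mon p q r s k2 k3) (i3 - u)"
  \<comment> \<open>The bounds say that the remaining exponents of w_2 in both factors are
    nonnegative, so the truncated subtractions are genuine.\<close>
  let ?T = "{u. u \<le> i3 \<and> u \<le> j2 + j3 \<and> i3 - u \<le> k2 + k3}"
  note valid = exps_valid[OF I] exps_valid[OF J] exps_valid[OF K]
  have ex: "exps (mi j1 (j2 + j3 - u) u) = (j1, j2 + j3 - u, u)"
    "exps (mi k1 (k2 + k3 - (i3 - u)) (i3 - u)) = (k1, k2 + k3 - (i3 - u), i3 - u)" if "u \<in> ?T" for u
    using that valid by (auto intro!: exps_mi)
  have "(\<Sum>(P, Q) | (P, Q) \<in> splits I \<and> parity P = j1 \<and> total_degree P = total_degree J.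
      coeff (dual_mon p q r s j2 j3) (snd (snd (exps P))) *
      coeff (dual_mon p q r s k2 k3) (snd (snd (exps Q)))) = (\<Sum>u\<in>?T. ?F u)"
  proof (rule sum.reindex_bij_witness[where j = "\<lambda>(P, Q). snd (snd (exps P))" and
        i = "\<lambda>u. (mi j1 (j2 + j3 - u) u, mi k1 (k2 + k3 - (i3 - u)) (i3 - u))"], goal_cases)
    case (1 z)
    obtain P Q where z: "z = (P, Q)" by (cases z)
    obtain q1 q2 q3 where Q: "exps Q = (q1, q2, q3)" by (cases "exps Q")
    show ?case
      using 1 valid i1 deg
      by (cases "exps P") (auto simp: z Q I J K splits_def parity_def total_degree_def mi_eq_iff)
  next
    case (2 z)
    obtain P Q where z: "z = (P, Q)" by (cases z)
    obtain q1 q2 q3 where Q: "exps Q = (q1, q2, q3)" by (cases "exps Q")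
    show ?case
      using 2 valid i1 deg
      by (cases "exps P") (auto simp: z Q I J K splits_def parity_def total_degree_def)
  next
    case (3 u)
    then show ?case using ex[of u] by simp
  next
    case (4 u)
    then show ?case
      using ex[of u] valid I J K i1 deg
      by (auto simp: splits_def parity_def total_degree_def)
  next
    case (5 z)
    obtain P Q where z: "z = (P, Q)" by (cases z)
    show ?case
      using 5 by (cases "exps P"; cases "exps Q") (auto simp: z I splits_def)
  qed
  \<comment> \<open>Outside \<open>?T\<close> one of the two coefficients lies above the degree
    bound and vanishes.\<close>
  also have "\<dots> = (\<Sum>u\<le>i3. ?F u)"
  proof (rule sum.mono_neutral_left)
    show "\<forall>u\<in>{..i3} - ?T. ?F u = 0"
      using degree_dual_mon[of p q r s j2 j3] degree_dual_mon[of p q r s k2 k3]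
      by (auto dest!: le_degree)
  qed auto
  also have "\<dots> = coeff (dual_mon p q r s (j2 + k2) (j3 + k3)) i3"
    by (simp add: dual_mon_def power_add ac_simps flip: coeff_mult)
  finally show ?thesis .
qed

lemma coalgebra_hom_linear_subst: "coalgebra_hom (linear_subst p q r s)"
proof (rule coalgebra_homI[OF complex_linear_linear_subst], rule poly_mapping_eqI)
  fix I and z :: "multi_index \<times> multi_index"
  let ?g = "linear_subst p q r s"
  obtain J K where z: "z = (J, K)" by (cases z)
  obtain i1 i2 i3 where I: "exps I = (i1, i2, i3)" by (cases "exps I")
  obtain j1 j2 j3 where J: "exps J = (j1, j2, j3)" by (cases "exps J")
  obtain k1 k2 k3 where K: "exps K = (k1, k2, k3)" by (cases "exps K")
  note valid = exps_valid[OF I] exps_valid[OF J] exps_valid[OF K]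
  define C where "C \<longleftrightarrow> i1 = j1 + k1 \<and> i2 + i3 = j2 + j3 + (k2 + k3)"
  define v :: complex where "v = fact i2 * fact i3 / (fact j2 * fact j3 * fact k2 * fact k3)"
  have left: "Poly_Mapping.lookup (coproduct (?g (mon I))) (J, K) =
      (if C then v * coeff (dual_mon p q r s (j2 + k2) (j3 + k3)) i3 else 0)"
  proof (cases "j1 + k1 \<le> 1")
    case True
    obtain L where L: "exps L = (j1 + k1, j2 + k2, j3 + k3)"
      using True valid by (intro that[OF exps_mi]) auto
    have "of_nat (multi_choose L J) * (fact i2 * fact i3 / (fact (j2 + k2) * fact (j3 + k3))) = v"
      using True by (cases j1) (auto simp: multi_choose_def L J choose_fact v_def ac_simps)
    then show ?thesis
      using lookup_coproduct[of J K L "?g (mon I)"]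
      by (auto simp: L J K lookup_linear_subst_mon[OF I L] C_def simp flip: mult.assoc)
  next
    case False
    then have "exps J + exps K \<noteq> exps L" for L
      using exps_valid by (cases "exps L") (fastforce simp: J K)
    then show ?thesis
      using False valid by (auto simp: lookup_coproduct_undefined C_def)
  qed
  let ?S = "{(P, Q). (P, Q) \<in> splits I \<and> parity P = j1 \<and> total_degree P = total_degree J}"
  let ?summand = "\<lambda>P Q. of_nat (multi_choose I P) *
    (Poly_Mapping.lookup (?g (mon P)) J * Poly_Mapping.lookup (?g (mon Q)) K)"
  have summand: "?summand P Q = (if C \<and> (P, Q) \<in> ?S then
      v * (coeff (dual_mon p q r s j2 j3) (snd (snd (exps P))) *
        coeff (dual_mon p q r s k2 k3) (snd (snd (exps Q)))) else 0)"
    if "(P, Q) \<in> splits I" for P Q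
  proof -
    obtain p1 p2 p3 where P: "exps P = (p1, p2, p3)" by (cases "exps P")
    obtain q1 q2 q3 where Q: "exps Q = (q1, q2, q3)" by (cases "exps Q")
    have sums: "i1 = p1 + q1" "i2 = p2 + q2" "i3 = p3 + q3"
      using that by (auto simp: splits_def I P Q)
    have cond: "C \<and> (P, Q) \<in> ?S \<longleftrightarrow>
        (j1 = p1 \<and> j2 + j3 = p2 + p3) \<and> (k1 = q1 \<and> k2 + k3 = q2 + q3)"
      using that sums by (auto simp: C_def parity_def total_degree_def P J)
    \<comment> \<open>The binomials cancel the factorials of \<open>P\<close> and \<open>Q\<close>,
      so the weight is the same for every split and factors out of the sum.\<close>
    have "of_nat (multi_choose I P) * (fact p2 * fact p3 / (fact j2 * fact j3) *
        (fact q2 * fact q3 / (fact k2 * fact k3))) = v"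
      using valid sums
      by (cases p1) (auto simp: multi_choose_def I P choose_fact v_def field_simps)
    then show ?thesis
      unfolding cond lookup_linear_subst_mon[OF P J] lookup_linear_subst_mon[OF Q K]
      by (auto simp: P Q algebra_simps)
  qed
  have "Poly_Mapping.lookup (tensor_map ?g 0 ?g (coproduct (mon I))) (J, K) =
      (\<Sum>(P, Q)\<in>splits I. ?summand P Q)"
    by (simp add: lookup_tensor_map_coproduct_mon)
  also have "\<dots> = (\<Sum>(P, Q)\<in>?S. ?summand P Q)"
    by (rule sum.mono_neutral_right) (auto simp: summand finite_splits split: if_splits)
  also have "\<dots> = (\<Sum>(P, Q)\<in>?S. if C then v * (coeff (dual_mon p q r s j2 j3) (snd (snd (exps P))) *
        coeff (dual_mon p q r s k2 k3) (snd (snd (exps Q)))) else 0)"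
    by (intro sum.cong) (auto simp: summand)
  also have "\<dots> = (if C then v * coeff (dual_mon p q r s (j2 + k2) (j3 + k3)) i3 else 0)"
  proof (cases C)
    case True
    then have "i1 = j1 + k1" "i2 + i3 = j2 + j3 + (k2 + k3)"
      by (auto simp: C_def)
    from sum_splits_dual_mon[OF I J K this, of p q r s, symmetric] True show ?thesis
      by (simp add: sum_distrib_left case_prod_unfold)
  qed auto
  finally show "Poly_Mapping.lookup (coproduct (?g (mon I))) z =
      Poly_Mapping.lookup (tensor_map ?g 0 ?g (coproduct (mon I))) z"
    by (simp add: z left)
qed

lemma map_parity_linear_subst: "map_parity 0 (linear_subst p q r s)"
  unfolding map_parity_def
proof (intro allI ballI)
  fix I J
  assume J: "J \<in> Poly_Mapping.keys (linear_subst p q r s (mon I))"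
  obtain i1 i2 i3 where ex: "exps I = (i1, i2, i3)" by (cases "exps I")
  obtain j1 j2 j3 where ex': "exps J = (j1, j2, j3)" by (cases "exps J")
  show "even (parity I + parity J + 0)"
    using J by (auto simp: in_keys_iff lookup_linear_subst_mon[OF ex ex'] parity_def ex ex'
        split: if_splits)
qed

lemma proj_W_linear_subst: "proj_W (linear_subst p q r s x) = linear_subst p q r s (proj_W x)"
proof -
  have "proj_W \<circ> linear_subst p q r s = linear_subst p q r s \<circ> proj_W"
  proof (rule complex_linear_eqI, fold mon_def)
    fix I
    show "(proj_W \<circ> linear_subst p q r s) (mon I) = (linear_subst p q r s \<circ> proj_W) (mon I)"
    proof (rule poly_mapping_eqI)
      fix J
      obtain i1 i2 i3 where ex: "exps I = (i1, i2, i3)" by (cases "exps I")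
      obtain j1 j2 j3 where ex': "exps J = (j1, j2, j3)" by (cases "exps J")
      show "Poly_Mapping.lookup ((proj_W \<circ> linear_subst p q r s) (mon I)) J =
          Poly_Mapping.lookup ((linear_subst p q r s \<circ> proj_W) (mon I)) J"
        by (auto simp: lookup_proj_W proj_W_mon lookup_linear_subst_mon[OF ex ex'] total_degree_def
            ex ex' complex_linear_0[OF complex_linear_linear_subst])
    qed
  qed (intro complex_linear_comp complex_linear_proj_W complex_linear_linear_subst)+
  then show ?thesis by (metis comp_apply)
qed

lemma total_degree_1_cases:
  assumes "total_degree I = 1"
  obtains "I = gen B1" | "I = gen B2" | "I = gen B3"
proof (cases I rule: multi_index_cases)
  case (1 i1 i2 i3)
  have "(i1, i2, i3) \<in> {(1, 0, 0), (0, 1, 0), (0, 0, 1)}"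
    using assms 1(4) by (auto simp: total_degree_def)
  then show ?thesis using that 1(1) by auto
qed

lemma exps_gen [simp]:
  "exps (mi (Suc 0) 0 0) = (Suc 0, 0, 0)" "exps (mi 0 (Suc 0) 0) = (0, Suc 0, 0)"
  "exps (mi 0 0 (Suc 0)) = (0, 0, Suc 0)"
  by (simp_all add: exps_mi)

lemma eq_gen_iff:
  "mi (Suc 0) 0 0 = J \<longleftrightarrow> exps J = (1, 0, 0)" "mi 0 (Suc 0) 0 = J \<longleftrightarrow> exps J = (0, 1, 0)"
  "mi 0 0 (Suc 0) = J \<longleftrightarrow> exps J = (0, 0, 1)"
  by (simp_all add: mi_eq_iff)

lemma linear_subst_gen:
  "linear_subst p q r s (mon (gen B1)) = mon (gen B1)"
  "linear_subst p q r s (mon (gen B2)) = scale p (mon (gen B2)) + scale q (mon (gen B3))"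
  "linear_subst p q r s (mon (gen B3)) = scale r (mon (gen B2)) + scale s (mon (gen B3))"
proof -
  have cases: "(j2 = 1 \<and> j3 = 0) \<or> (j2 = 0 \<and> j3 = 1)" if "j2 + j3 = Suc 0" for j2 j3 :: nat
    using that by auto
  have "Poly_Mapping.lookup (linear_subst p q r s (mon (gen B1))) J = Poly_Mapping.lookup (mon (gen B1)) J \<and>
    Poly_Mapping.lookup (linear_subst p q r s (mon (gen B2))) J =
      Poly_Mapping.lookup (scale p (mon (gen B2)) + scale q (mon (gen B3))) J \<and>
    Poly_Mapping.lookup (linear_subst p q r s (mon (gen B3))) J =
      Poly_Mapping.lookup (scale r (mon (gen B2)) + scale s (mon (gen B3))) J" for J
  proof -
    obtain j1 j2 j3 where J: "exps J = (j1, j2, j3)" by (cases "exps J")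
    note lookup = lookup_linear_subst_mon[OF exps_gen(1) J] lookup_linear_subst_mon[OF exps_gen(2) J]
      lookup_linear_subst_mon[OF exps_gen(3) J]
    show ?thesis
      by (cases "j2 + j3 = Suc 0"; (drule cases)?)
        (auto simp: lookup lookup_add lookup_mon eq_gen_iff J dual_mon_def)
  qed
  then show "linear_subst p q r s (mon (gen B1)) = mon (gen B1)"
    "linear_subst p q r s (mon (gen B2)) = scale p (mon (gen B2)) + scale q (mon (gen B3))"
    "linear_subst p q r s (mon (gen B3)) = scale r (mon (gen B2)) + scale s (mon (gen B3))"
    by (auto intro: poly_mapping_eqI)
qed

text \<open>The hypotheses say that the two matrices multiply to the identity; uniqueness of
  morphisms carries this from \<open>W\<close> to all degrees without any higher polynomial
  identity.\<close>

lemma linear_subst_inverse: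
  assumes "p * p' + q * r' = 1" "p * q' + q * s' = 0" "r * p' + s * r' = 0" "r * q' + s * s' = 1"
  shows "linear_subst p' q' r' s' (linear_subst p q r s x) = x"
proof -
  note lin = complex_linear_linear_subst
  have "linear_subst p' q' r' s' \<circ> linear_subst p q r s = id"
  proof (rule coalgebra_hom_eqI[OF coalgebra_hom_comp coalgebra_hom_id])
    fix I
    have comb: "scale u (scale a x + scale b y) + scale v (scale c x + scale d y) =
        scale (u * a + v * c) x + scale (u * b + v * d) y" for u v a b c d and x y :: SW
      by (rule poly_mapping_eqI) (simp add: lookup_add algebra_simps)
    have "linear_subst p' q' r' s' (linear_subst p q r s (mon I)) = mon I" if "total_degree I = 1"
      using that
      by (cases rule: total_degree_1_cases)
        (simp_all only: linear_subst_gen complex_linear_add[OF lin] complex_linear_scale[OF lin] comb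
          assms scale_simps add_0_left add_0_right)
    then show "proj_W ((linear_subst p' q' r' s' \<circ> linear_subst p q r s) (mon I)) = proj_W (id (mon I))"
      by (simp add: proj_W_linear_subst proj_W_mon complex_linear_0[OF lin])
  qed (rule coalgebra_hom_linear_subst)+
  then show ?thesis by (metis comp_apply id_apply)
qed

lemma coalgebra_automorphism_linear_subst:
  assumes "p * s - q * r \<noteq> 0"
  shows "coalgebra_automorphism (linear_subst p q r s)"
proof -
  let ?d = "p * s - q * r"
  have "bij (linear_subst p q r s)"
  proof (rule o_bij)
    show "linear_subst (s / ?d) (- q / ?d) (- r / ?d) (p / ?d) \<circ> linear_subst p q r s = id"
      "linear_subst p q r s \<circ> linear_subst (s / ?d) (- q / ?d) (- r / ?d) (p / ?d) = id"
      using assms by (auto simp: fun_eq_iff divide_simps intro!: linear_subst_inverse)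
  qed
  then show ?thesis
    using coalgebra_hom_linear_subst
    by (auto simp: coalgebra_automorphism_def coalgebra_hom_def map_parity_linear_subst)
qed

subsection \<open>Quadratic forms\<close>

lemma phi_eq: "phi I j x = scale (of_nat (multi_fact I) * Poly_Mapping.lookup x I) (mon (gen j))"
proof -
  have "phi I j x = (\<Sum>J\<in>Poly_Mapping.keys x. if J = I then
      scale (of_nat (multi_fact I) * Poly_Mapping.lookup x I) (mon (gen j)) else 0)"
    unfolding phi_def lin_ext_def by (intro sum.cong) (auto simp: mult.commute)
  then show ?thesis by (auto simp: in_keys_iff)
qed

lemma exps_quad [simp]:
  "exps (mi 0 2 0) = (0, 2, 0)" "exps (mi 0 (Suc 0) (Suc 0)) = (0, 1, 1)" "exps (mi 0 0 2) = (0, 0, 2)"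
  by (simp_all add: exps_mi)

lemma second_kind_eq:
  "second_kind a b c x = scale (2 * a * Poly_Mapping.lookup x (mi 0 2 0) +
     b * Poly_Mapping.lookup x (mi 0 1 1) + 2 * c * Poly_Mapping.lookup x (mi 0 0 2)) (mon (gen B1))"
  by (rule poly_mapping_eqI)
    (simp add: second_kind_def phi_eq lookup_add multi_fact_def algebra_simps)

text \<open>The primed coefficients are those of the form after x is replaced by px + ry and y by qx
  + sy. The doubled terms in the proof come from 2! in \<open>phi\<close>.\<close>

lemma linear_subst_second_kind:
  assumes "a' = a * p\<^sup>2 + b * p * q + c * q\<^sup>2"
    and "b' = 2 * a * p * r + b * (p * s + q * r) + 2 * c * q * s"
    and "c' = a * r\<^sup>2 + b * r * s + c * s\<^sup>2"
  shows "second_kind a b c (linear_subst p q r s (mon I)) =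
    linear_subst p q r s (second_kind a' b' c' (mon I))"
proof -
  obtain i1 i2 i3 where I: "exps I = (i1, i2, i3)" by (cases "exps I")
  have eq: "I = mi 0 2 0 \<longleftrightarrow> exps I = (0, 2, 0)" "I = mi 0 (Suc 0) (Suc 0) \<longleftrightarrow> exps I = (0, 1, 1)"
    "I = mi 0 0 2 \<longleftrightarrow> exps I = (0, 0, 2)"
    unfolding eq_commute[of I] by (simp_all add: mi_eq_iff)
  have dual: "dual_mon p q r s 2 0 = [:p\<^sup>2, 2 * p * r, r\<^sup>2:]"
    "dual_mon p q r s (Suc 0) (Suc 0) = [:p * q, p * s + q * r, r * s:]"
    "dual_mon p q r s 0 2 = [:q\<^sup>2, 2 * q * s, s\<^sup>2:]"
    by (simp_all add: dual_mon_def power2_eq_square algebra_simps)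
  have coeff3: "coeff [:x, y, z:] 0 = x" "coeff [:x, y, z:] (Suc 0) = y" "coeff [:x, y, z:] 2 = z"
    for x y z :: complex
    by (simp_all add: numeral_2_eq_2)
  note lookup = lookup_linear_subst_mon[OF _ exps_quad(1)] lookup_linear_subst_mon[OF _ exps_quad(2)]
    lookup_linear_subst_mon[OF _ exps_quad(3)]
  consider "exps I = (0, 2, 0)" | "exps I = (0, 1, 1)" | "exps I = (0, 0, 2)" | "i1 \<noteq> 0 \<or> i2 + i3 \<noteq> 2"
    unfolding I by fastforce
  then have "2 * a * Poly_Mapping.lookup (linear_subst p q r s (mon I)) (mi 0 2 0) +
      b * Poly_Mapping.lookup (linear_subst p q r s (mon I)) (mi 0 (Suc 0) (Suc 0)) +
      2 * c * Poly_Mapping.lookup (linear_subst p q r s (mon I)) (mi 0 0 2) =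
    2 * a' * Poly_Mapping.lookup (mon I) (mi 0 2 0) + b' * Poly_Mapping.lookup (mon I) (mi 0 (Suc 0) (Suc 0)) +
      2 * c' * Poly_Mapping.lookup (mon I) (mi 0 0 2)"
  proof cases
    case 1
    show ?thesis
      unfolding lookup[OF 1] by (simp add: lookup_mon eq 1 dual coeff3 assms(1); simp add: algebra_simps)
  next
    case 2
    show ?thesis
      unfolding lookup[OF 2] by (simp add: lookup_mon eq 2 dual coeff3 assms(2); simp add: algebra_simps)
  next
    case 3
    show ?thesis
      unfolding lookup[OF 3] by (simp add: lookup_mon eq 3 dual coeff3 assms(3); simp add: algebra_simps)
  next
    case 4
    \<comment> \<open>The substitution preserves degree and the exponent of w_1, so nothing reaches
      an even quadratic monomial.\<close>
    have "Poly_Mapping.lookup (linear_subst p q r s (mon I)) L = 0 \<and> Poly_Mapping.lookup (mon I) L = 0"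
      if L: "exps L = (0, l2, l3)" "l2 + l3 = 2" for L l2 l3
    proof -
      have "I \<noteq> L" "\<not> (0 = i1 \<and> l2 + l3 = i2 + i3)"
        using 4 L I by auto
      then show ?thesis
        by (auto simp: lookup_linear_subst_mon[OF I L(1)] lookup_mon)
    qed
    then have "Poly_Mapping.lookup (linear_subst p q r s (mon I)) L = 0 \<and> Poly_Mapping.lookup (mon I) L = 0"
      if "L \<in> {mi 0 2 0, mi 0 (Suc 0) (Suc 0), mi 0 0 2}" for L
      using that by fastforce
    then show ?thesis by simp
  qed
  then show ?thesis
    by (simp add: second_kind_eq complex_linear_scale[OF complex_linear_linear_subst]
        linear_subst_gen del: gen.simps)
qed

text \<open>The intertwining relation is an equality of coderivations along the substitution, hence
  follows from its projection to \<open>W\<close>; cancelling the bijection turns it into a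
  conjugation.\<close>

lemma codiff_equivalent_second_kind:
  assumes "p * s - q * r \<noteq> 0"
    and "a' = a * p\<^sup>2 + b * p * q + c * q\<^sup>2"
    and "b' = 2 * a * p * r + b * (p * s + q * r) + 2 * c * q * s"
    and "c' = a * r\<^sup>2 + b * r * s + c * s\<^sup>2"
  shows "codiff_equivalent (second_kind a b c) (second_kind a' b' c')"
proof -
  let ?g = "linear_subst p q r s"
  have "quad_coder a b c \<circ> ?g = ?g \<circ> quad_coder a' b' c'"
  proof (rule coderivation_along_eqI)
    show "coderivation_along ?g 1 (quad_coder a b c \<circ> ?g)"
      by (intro coderivation_comp_hom coderivation_quad_coder coalgebra_hom_linear_subst
          map_parity_linear_subst)
    show "coderivation_along ?g 1 (?g \<circ> quad_coder a' b' c')"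
      by (intro hom_comp_coderivation coderivation_quad_coder coalgebra_hom_linear_subst)
    show "proj_W ((quad_coder a b c \<circ> ?g) (mon I)) = proj_W ((?g \<circ> quad_coder a' b' c') (mon I))" for I
      using linear_subst_second_kind[OF assms(2-4)]
      by (simp add: proj_W_quad_coder proj_W_linear_subst)
  qed
  then have "inv ?g \<circ> (quad_coder a b c \<circ> ?g) = inv ?g \<circ> ?g \<circ> quad_coder a' b' c'"
    by (simp add: comp_assoc)
  also have "\<dots> = quad_coder a' b' c'"
    using coalgebra_automorphism_linear_subst[OF assms(1)]
    by (simp add: coalgebra_automorphism_def bij_def inv_o_cancel)
  finally have "coder 1 (second_kind a' b' c') = inv ?g \<circ> coder 1 (second_kind a b c) \<circ> ?g"
    by (simp only: coder_second_kind comp_assoc)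
  then show ?thesis
    unfolding codiff_equivalent_def
    using codifferential_second_kind coalgebra_automorphism_linear_subst[OF assms(1)] by blast
qed

section \<open>Conditions forced by an equivalence\<close>

lemma splits_quad:
  "splits (mi 0 2 0) = {(mi 0 1 0, mi 0 1 0)}"
  "splits (mi 0 1 1) = {(mi 0 1 0, mi 0 0 1), (mi 0 0 1, mi 0 1 0)}"
  "splits (mi 0 0 2) = {(mi 0 0 1, mi 0 0 1)}"
proof -
  have cases: "J = mi 0 1 0 \<and> K = mi 0 1 0 \<and> (i2, i3) = (2, 0) \<or>
      J = mi 0 1 0 \<and> K = mi 0 0 1 \<and> (i2, i3) = (1, 1) \<or>
      J = mi 0 0 1 \<and> K = mi 0 1 0 \<and> (i2, i3) = (1, 1) \<or>
      J = mi 0 0 1 \<and> K = mi 0 0 1 \<and> (i2, i3) = (0, 2)"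
    if sum: "exps J + exps K = (0, i2, i3)" and deg: "i2 + i3 = 2" for J K and i2 i3 :: nat
  proof -
    obtain j1 j2 j3 where J: "J = mi j1 j2 j3" "exps J = (j1, j2, j3)" "1 \<le> j1 + j2 + j3"
      by (cases J rule: multi_index_cases)
    obtain k1 k2 k3 where K: "K = mi k1 k2 k3" "exps K = (k1, k2, k3)" "1 \<le> k1 + k2 + k3"
      by (cases K rule: multi_index_cases)
    have "j1 = 0" "k1 = 0" "i2 = j2 + k2" "i3 = j3 + k3" "j2 + j3 = 1" "k2 + k3 = 1"
      using sum deg J K by auto
    moreover from this have "j2 = 1 \<and> j3 = 0 \<or> j2 = 0 \<and> j3 = 1" "k2 = 1 \<and> k3 = 0 \<or> k2 = 0 \<and> k3 = 1"
      by auto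
    ultimately show ?thesis
      unfolding J(1) K(1) by auto
  qed
  show "splits (mi 0 2 0) = {(mi 0 1 0, mi 0 1 0)}"
    using cases[where ?i2.0 = 2 and ?i3.0 = 0] by (auto simp: splits_def)
  show "splits (mi 0 1 1) = {(mi 0 1 0, mi 0 0 1), (mi 0 0 1, mi 0 1 0)}"
    using cases[where ?i2.0 = 1 and ?i3.0 = 1] by (auto simp: splits_def)
  show "splits (mi 0 0 2) = {(mi 0 0 1, mi 0 0 1)}"
    using cases[where ?i2.0 = 0 and ?i3.0 = 2] by (auto simp: splits_def)
qed

text \<open>When \<open>I\<close> is quadratic, all factors on the right lie in \<open>W\<close>;
  the quadratic part of \<open>g\<close> there is therefore governed by its linear part
  alone.\<close>

lemma lookup_coalgebra_hom:
  assumes "coalgebra_hom g" and split: "exps J + exps K = exps L"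
  shows "of_nat (multi_choose L J) * Poly_Mapping.lookup (g (mon I)) L =
    (\<Sum>(P, Q)\<in>splits I. of_nat (multi_choose I P) *
        (Poly_Mapping.lookup (g (mon P)) J * Poly_Mapping.lookup (g (mon Q)) K))"
  using lookup_coproduct[OF split, of "g (mon I)"] coalgebra_homD(2)[OF assms(1), of "mon I"]
  by (simp add: lookup_tensor_map_coproduct_mon)

text \<open>A second-order operator leaves only a multiple of w_1, so a subsequent automorphism is
  evaluated on w_1 alone.\<close>

lemma quad_coder_degree_2:
  assumes "total_degree I = 2"
  shows "quad_coder a b c (mon I) = second_kind a b c (mon I)"
  unfolding proj_W_quad_coder[symmetric]
proof (rule poly_mapping_eqI)
  fix J
  obtain j1 j2 j3 where J: "exps J = (j1, j2, j3)" by (cases "exps J")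
  show "Poly_Mapping.lookup (quad_coder a b c (mon I)) J =
      Poly_Mapping.lookup (proj_W (quad_coder a b c (mon I))) J"
    using assms
    by (auto simp: lookup_proj_W quad_coder_def lookup_add lookup_diff_op_mon[OF J] total_degree_def J)
qed

text \<open>Automorphisms preserve primitive elements, and the primitive elements are those of \<open>W\<close>.\<close>

lemma automorphism_linear_part:
  assumes g: "coalgebra_automorphism g"
  obtains l p q r s where
    "g (mon (gen B1)) = scale l (mon (gen B1))"
    "g (mon (gen B2)) = scale p (mon (gen B2)) + scale q (mon (gen B3))"
    "g (mon (gen B3)) = scale r (mon (gen B2)) + scale s (mon (gen B3))"
    "l \<noteq> 0" "p * s - q * r \<noteq> 0"
proof -
  have lin: "complex_linear g" and par: "map_parity 0 g" and hom: "coalgebra_hom g" and inj: "inj g"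
    using g by (auto simp: coalgebra_automorphism_def coalgebra_hom_def bij_def)
  have zero: "Poly_Mapping.lookup (g (mon I)) J = 0"
    if I: "total_degree I = 1" and J: "total_degree J \<noteq> 1 \<or> parity J \<noteq> parity I" for I J
  proof (cases "total_degree J = 1")
    case True
    then have "odd (parity I + parity J + 0)"
      using J parity_le_1[of I] parity_le_1[of J] by (auto simp: le_Suc_eq)
    then show ?thesis
      using par unfolding map_parity_def by (metis in_keys_iff)
  next
    case False
    have "(P, Q) \<notin> splits I" for P Q
      using total_degree_splits[of P Q I] total_degree_ge_1[of P] total_degree_ge_1[of Q] I by auto
    then have "splits I = {}" by auto
    then have "coproduct (g (mon I)) = coproduct 0"
      by (simp add: coalgebra_homD(2)[OF hom] tensor_map_coproduct_mon
          complex_linear_0[OF complex_linear_coproduct])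
    from coproduct_determines[OF this False] show ?thesis by simp
  qed
  define l where "l = Poly_Mapping.lookup (g (mon (gen B1))) (gen B1)"
  define p where "p = Poly_Mapping.lookup (g (mon (gen B2))) (gen B2)"
  define q where "q = Poly_Mapping.lookup (g (mon (gen B2))) (gen B3)"
  define r where "r = Poly_Mapping.lookup (g (mon (gen B3))) (gen B2)"
  define s where "s = Poly_Mapping.lookup (g (mon (gen B3))) (gen B3)"
  have deg: "total_degree (gen j) = 1" "parity (gen j) = (if j = B1 then 1 else 0)" for j
    by (cases j; simp add: total_degree_def parity_def)+
  have neq: "gen B1 \<noteq> gen B2" "gen B1 \<noteq> gen B3" "gen B2 \<noteq> gen B3"
    "gen B2 \<noteq> gen B1" "gen B3 \<noteq> gen B1" "gen B3 \<noteq> gen B2"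
    by (auto simp: eq_gen_iff)
  have expand: "x = scale (Poly_Mapping.lookup x (gen B1)) (mon (gen B1)) +
      scale (Poly_Mapping.lookup x (gen B2)) (mon (gen B2)) +
      scale (Poly_Mapping.lookup x (gen B3)) (mon (gen B3))"
    if "\<And>J. total_degree J \<noteq> 1 \<Longrightarrow> Poly_Mapping.lookup x J = 0" for x :: SW
  proof (rule poly_mapping_eqI)
    fix J
    show "Poly_Mapping.lookup x J = Poly_Mapping.lookup (scale (Poly_Mapping.lookup x (gen B1)) (mon (gen B1)) +
      scale (Poly_Mapping.lookup x (gen B2)) (mon (gen B2)) +
      scale (Poly_Mapping.lookup x (gen B3)) (mon (gen B3))) J"
    proof (cases "total_degree J = 1")
      case True
      then show ?thesis
        by (cases rule: total_degree_1_cases) (simp_all add: lookup_add lookup_mon neq del: gen.simps)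
    next
      case False
      then have "J \<noteq> gen j" for j using deg by auto
      then show ?thesis
        using that[OF False] by (auto simp: lookup_add lookup_mon simp del: gen.simps)
    qed
  qed
  have g1: "g (mon (gen B1)) = scale l (mon (gen B1))"
    using expand[of "g (mon (gen B1))"] zero[of "gen B1"] by (simp add: l_def deg del: gen.simps)
  have g2: "g (mon (gen B2)) = scale p (mon (gen B2)) + scale q (mon (gen B3))"
    using expand[of "g (mon (gen B2))"] zero[of "gen B2"] by (simp add: p_def q_def deg del: gen.simps)
  have g3: "g (mon (gen B3)) = scale r (mon (gen B2)) + scale s (mon (gen B3))"
    using expand[of "g (mon (gen B3))"] zero[of "gen B3"] by (simp add: r_def s_def deg del: gen.simps)
  have kernel: "x = 0" if "g x = 0" for x
    using inj that complex_linear_0[OF lin] by (metis injD)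
  have mon_nz: "mon I \<noteq> 0" for I
    by (metis keys_mon keys_zero insert_not_empty)
  have "l \<noteq> 0"
    using kernel[of "mon (gen B1)"] mon_nz by (auto simp: g1 simp del: gen.simps)
  moreover have "p * s - q * r \<noteq> 0"
  proof
    assume det: "p * s - q * r = 0"
    have g_comb: "g (scale u (mon (gen B2)) + scale v (mon (gen B3))) =
        scale (u * p + v * r) (mon (gen B2)) + scale (u * q + v * s) (mon (gen B3))" for u v
      by (rule poly_mapping_eqI)
        (simp add: complex_linear_add[OF lin] complex_linear_scale[OF lin] g2 g3 lookup_add algebra_simps
          del: gen.simps)
    have comb: "u = 0 \<and> v = 0" if "u * p + v * r = 0" "u * q + v * s = 0" for u v
    proof -
      have "scale u (mon (gen B2)) + scale v (mon (gen B3)) = 0"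
        by (rule kernel) (simp add: g_comb that del: gen.simps)
      then have "Poly_Mapping.lookup (scale u (mon (gen B2)) + scale v (mon (gen B3))) J = 0" for J
        by simp
      from this[of "gen B2"] this[of "gen B3"] show ?thesis
        by (simp add: lookup_add lookup_mon neq del: gen.simps)
    qed
    \<comment> \<open>The rows of the adjugate solve the linear system when the determinant
      vanishes. Injectivity forces them to be zero, after which \<open>u = v = 1\<close> is a
      solution as well.\<close>
    have "s = 0 \<and> - q = 0" "- r = 0 \<and> p = 0"
      using det by (intro comb; simp add: algebra_simps)+
    with comb[of 1 1] show False by simp
  qed
  ultimately show ?thesis using that g1 g2 g3 by blast
qed

lemma second_kind_equivalence_necessary:
  assumes "codiff_equivalent (second_kind a b c) (second_kind a' b' c')"
  obtains l p q r s where "l \<noteq> 0" "p * s - q * r \<noteq> 0"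
    "l * a' = a * p\<^sup>2 + b * p * q + c * q\<^sup>2"
    "l * b' = 2 * a * p * r + b * (p * s + q * r) + 2 * c * q * s"
    "l * c' = a * r\<^sup>2 + b * r * s + c * s\<^sup>2"
proof -
  from assms obtain g where g: "coalgebra_automorphism g"
    and conj: "quad_coder a' b' c' = inv g \<circ> quad_coder a b c \<circ> g"
    unfolding codiff_equivalent_def coder_second_kind by blast
  have lin: "complex_linear g" and hom: "coalgebra_hom g" and surj: "surj g"
    using g by (auto simp: coalgebra_automorphism_def coalgebra_hom_def bij_def)
  obtain l p q r s where g1: "g (mon (gen B1)) = scale l (mon (gen B1))"
    and g2: "g (mon (gen B2)) = scale p (mon (gen B2)) + scale q (mon (gen B3))"
    and g3: "g (mon (gen B3)) = scale r (mon (gen B2)) + scale s (mon (gen B3))"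
    and nz: "l \<noteq> 0" "p * s - q * r \<noteq> 0"
    by (rule automorphism_linear_part[OF g])
  have comm: "g (quad_coder a' b' c' x) = quad_coder a b c (g x)" for x
    by (simp add: conj surj_f_inv_f[OF surj])
  have lookup_W1: "Poly_Mapping.lookup (g (second_kind a' b' c' (mon I))) (gen B1) =
      Poly_Mapping.lookup (second_kind a b c (g (mon I))) (gen B1)" if "total_degree I = 2" for I
    using comm[of "mon I"] lookup_proj_W[of "quad_coder a b c (g (mon I))" "gen B1"]
    by (simp add: quad_coder_degree_2[OF that] proj_W_quad_coder total_degree_def)
  have quad: "l * (2 * a' * Poly_Mapping.lookup (mon I) (mi 0 2 0) +
      b' * Poly_Mapping.lookup (mon I) (mi 0 1 1) + 2 * c' * Poly_Mapping.lookup (mon I) (mi 0 0 2)) =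
    2 * a * Poly_Mapping.lookup (g (mon I)) (mi 0 2 0) +
      b * Poly_Mapping.lookup (g (mon I)) (mi 0 1 1) + 2 * c * Poly_Mapping.lookup (g (mon I)) (mi 0 0 2)"
    if "total_degree I = 2" for I
    using lookup_W1[OF that]
    by (simp add: second_kind_eq complex_linear_scale[OF lin] g1[simplified] lookup_mon mult.commute)
  have ex: "exps (mi 0 1 0) + exps (mi 0 1 0) = exps (mi 0 2 0)"
    "exps (mi 0 1 0) + exps (mi 0 0 1) = exps (mi 0 1 1)"
    "exps (mi 0 0 1) + exps (mi 0 0 1) = exps (mi 0 0 2)"
    by simp_all
  note lookup_g = lookup_coalgebra_hom[OF hom ex(1)] lookup_coalgebra_hom[OF hom ex(2)]
    lookup_coalgebra_hom[OF hom ex(3)]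
  note simps = splits_quad multi_choose_def g2[simplified] g3[simplified] lookup_add lookup_mon
    eq_gen_iff mi_eq_iff total_degree_def
  have "2 * (l * a') = 2 * (a * p\<^sup>2 + b * p * q + c * q\<^sup>2)"
    using quad[of "mi 0 2 0"] lookup_g[of "mi 0 2 0"]
    by (simp add: simps splits_quad[simplified] power2_eq_square algebra_simps)
  moreover have "l * b' = 2 * a * p * r + b * (p * s + q * r) + 2 * c * q * s"
    using quad[of "mi 0 1 1"] lookup_g[of "mi 0 1 1"]
    by (simp add: simps splits_quad[simplified] power2_eq_square algebra_simps)
  moreover have "2 * (l * c') = 2 * (a * r\<^sup>2 + b * r * s + c * s\<^sup>2)"
    using quad[of "mi 0 0 2"] lookup_g[of "mi 0 0 2"]
    by (simp add: simps splits_quad[simplified] power2_eq_square algebra_simps)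
  ultimately show ?thesis using that nz by (simp only: mult_cancel_left) simp
qed

text \<open>Substitution multiplies the discriminant by the squared determinant and rescaling by
  \<open>l\<close> multiplies it by \<open>l\<^sup>2\<close>; both factors are nonzero.\<close>

lemma discriminant_invariant:
  assumes "codiff_equivalent (second_kind a b c) (second_kind a' b' c')"
  shows "b\<^sup>2 = 4 * a * c \<longleftrightarrow> b'\<^sup>2 = 4 * a' * c'"
proof -
  obtain l p q r s where nz: "l \<noteq> 0" "p * s - q * r \<noteq> 0" and eqs:
    "l * a' = a * p\<^sup>2 + b * p * q + c * q\<^sup>2"
    "l * b' = 2 * a * p * r + b * (p * s + q * r) + 2 * c * q * s"
    "l * c' = a * r\<^sup>2 + b * r * s + c * s\<^sup>2"
    by (rule second_kind_equivalence_necessary[OF assms])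
  have "l\<^sup>2 * (b'\<^sup>2 - 4 * a' * c') = (l * b')\<^sup>2 - 4 * (l * a') * (l * c')"
    by (simp add: power2_eq_square algebra_simps)
  also have "\<dots> = (p * s - q * r)\<^sup>2 * (b\<^sup>2 - 4 * a * c)"
    unfolding eqs by (simp add: power2_eq_square algebra_simps)
  finally have "l\<^sup>2 * (b'\<^sup>2 - 4 * a' * c') = (p * s - q * r)\<^sup>2 * (b\<^sup>2 - 4 * a * c)" .
  with nz show ?thesis
    by (metis mult_eq_0_iff power_not_zero right_minus_eq)
qed

section \<open>Normal forms of binary quadratic forms over the complex numbers\<close>

lemma degenerate_equivalent:
  assumes disc: "b\<^sup>2 = 4 * a * c" and nz: "(a, b, c) \<noteq> (0, 0, 0)"
  shows "codiff_equivalent (second_kind a b c) (second_kind 1 0 0)"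
proof (cases "a = 0")
  case True
  then have "b = 0" "c \<noteq> 0" using assms by auto
  \<comment> \<open>The form is cy^2: \<open>q\<close> normalises c to 1, \<open>s = 0\<close>
    removes the other terms, and \<open>r = 1\<close> keeps the determinant nonzero.\<close>
  then show ?thesis
    using True by (intro codiff_equivalent_second_kind[where p = 0 and q = "1 / csqrt c" and r = 1 and s = 0])
      (auto simp: power_divide)
next
  case False
  \<comment> \<open>The vector \<open>(r, s) = (- b, 2 * a)\<close> spans the double root, where the
    form and its polarisation vanish; \<open>p\<close> normalises the leading coefficient.\<close>
  then show ?thesis
    using disc
    by (intro codiff_equivalent_second_kind[where p = "1 / csqrt a" and q = 0 and r = "- b" and s = "2 * a"])
      (simp_all add: power_divide, simp_all add: power2_eq_square)
qed

lemma nondegenerate_equivalent: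
  assumes disc: "b\<^sup>2 \<noteq> 4 * a * c"
  shows "codiff_equivalent (second_kind a b c) (second_kind 0 1 0)"
proof (cases "a = 0")
  case True
  then have "b \<noteq> 0" using disc by auto
  \<comment> \<open>The form is y(bx + cy). The rows lie on its root lines y = 0 and bx + cy = 0,
    the second scaled so that the mixed coefficient is 1.\<close>
  then show ?thesis
    using True
    by (intro codiff_equivalent_second_kind[where p = 1 and q = 0 and r = "- c / b\<^sup>2" and s = "1 / b"])
      (simp_all add: power2_eq_square)
next
  case False
  define e where "e = csqrt (b\<^sup>2 - 4 * a * c)"
  have e: "e\<^sup>2 = b\<^sup>2 - 4 * a * c" "e \<noteq> 0"
    using disc by (auto simp: e_def)
  \<comment> \<open>Eliminating \<open>c\<close> in favour of the root \<open>e\<close> turns the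
    remaining identities into rational ones in \<open>a\<close>, \<open>b\<close>,
    \<open>e\<close>.\<close>
  have c: "c = (b\<^sup>2 - e\<^sup>2) / (4 * a)"
    using e False by (simp add: field_simps)
  show ?thesis
  proof (rule codiff_equivalent_second_kind)
    \<comment> \<open>The rows span the two root lines. With second coordinates 1, the mixed
      coefficient would be \<open>- e\<^sup>2 / a\<close>, hence the factor
      \<open>- a / e\<^sup>2\<close> on the second row.\<close>
    let ?p = "(- b + e) / (2 * a)" and ?r = "(b + e) / (2 * e\<^sup>2)" and ?s = "- a / e\<^sup>2"
    show "?p * ?s - 1 * ?r \<noteq> 0"
      using False e(2) by (simp add: field_simps power2_eq_square)
    show "0 = a * ?p\<^sup>2 + b * ?p * 1 + c * 1\<^sup>2"
      unfolding c using False by (simp add: field_simps power2_eq_square)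
    show "1 = 2 * a * ?p * ?r + b * (?p * ?s + 1 * ?r) + 2 * c * 1 * ?s"
      unfolding c using False e(2) by (simp add: field_simps power2_eq_square)
    show "0 = a * ?r\<^sup>2 + b * ?r * ?s + c * ?s\<^sup>2"
      unfolding c using False e(2) by (simp add: field_simps power2_eq_square)
  qed
qed

theorem mainTheorem3:
  fixes a b c :: complex and d :: "SW \<Rightarrow> SW"
  assumes "d = second_kind a b c"
    and "d \<noteq> (\<lambda>x. 0)"
  shows "(codiff_equivalent d (phi (mi 0 2 0) B1) \<and> \<not> codiff_equivalent d (phi (mi 0 1 1) B1)) \<or>
         (\<not> codiff_equivalent d (phi (mi 0 2 0) B1) \<and> codiff_equivalent d (phi (mi 0 1 1) B1))"
proof -
  have phi: "phi (mi 0 2 0) B1 = second_kind 1 0 0" "phi (mi 0 1 1) B1 = second_kind 0 1 0"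
    by (simp_all add: second_kind_def fun_eq_iff)
  have nz: "(a, b, c) \<noteq> (0, 0, 0)"
    using assms by (auto simp: second_kind_def)
  show ?thesis
  \<comment> \<open>The two normal forms have discriminants 0 and 1, so invariance excludes the one
    that does not match.\<close>
  proof (cases "b\<^sup>2 = 4 * a * c")
    case True
    then show ?thesis
      using degenerate_equivalent[OF True nz] discriminant_invariant[of a b c 0 1 0]
      unfolding phi assms(1) by auto
  next
    case False
    then show ?thesis
      using nondegenerate_equivalent[OF False] discriminant_invariant[of a b c 1 0 0]
      unfolding phi assms(1) by auto
  qed
qed

end
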